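(* The following two assertions (Conjectures 5.2 and 5.3 of Neuhaus) cannot both be true: (i) there exists $n_0$ such that for all $n\ge n_0$ every minimum dominating set of the queen's graph $Q_n$ is an orthodox cover; (ii) for every $n\ge1$ with $n\notin\{3,11\}$, $\gamma(Q_n)\in\{\lceil n/2\rceil,\ \lceil n/2\rceil+1\}$.
   Context: The queen's graph $Q_n$ has as vertices the squares $(x,y)\in\{0,\ldots,n-1\}^2$ of the $n\times n$ chessboard ($x$ is the column index, $y$ the row index); two distinct squares are adjacent if they share a row, a column, or a diagonal ($y-x$ equal or $x+y$ equal). A set $C$ of squares is a dominating set if every square belongs to $C$ or is adjacent to a square of $C$; $\gamma(Q_n)$ is the minimum size of a dominating set, and a minimum dominating set is a dominating set of size $\gamma(Q_n)$. A dominating set $C$ is an orthodox cover if there exist $p,q\in\{0,1\}$ (possibly different) such that every column of index parity $p$ and every row of index parity $q$ contains an element of $C$. *)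

theory Defs
  imports Complex_Main
begin

text \<open>A graph is given by its vertex set \<open>V\<close> and its adjacency relation \<open>adj\<close>.\<close>

definition dominating_set :: "'a set \<Rightarrow> ('a \<Rightarrow> 'a \<Rightarrow> bool) \<Rightarrow> 'a set \<Rightarrow> bool" where
  "dominating_set V adj C \<longleftrightarrow> C \<subseteq> V \<and> (\<forall>v\<in>V. v \<in> C \<or> (\<exists>c\<in>C. adj v c))"

text \<open>Meaningful for finite \<open>V\<close>, where \<open>V\<close> itself is a dominating set and
  \<open>card\<close> is the number of elements of any \<open>C \<subseteq> V\<close>.\<close>

definition domination_number :: "'a set \<Rightarrow> ('a \<Rightarrow> 'a \<Rightarrow> bool) \<Rightarrow> nat" where
  "domination_number V adj = (LEAST k. \<exists>C. dominating_set V adj C \<and> card C = k)"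

definition minimum_dominating_set :: "'a set \<Rightarrow> ('a \<Rightarrow> 'a \<Rightarrow> bool) \<Rightarrow> 'a set \<Rightarrow> bool" where
  "minimum_dominating_set V adj C \<longleftrightarrow>
     dominating_set V adj C \<and> card C = domination_number V adj"

text \<open>Squares are pairs (column, row) of integers, so that \<open>y - x\<close> is not truncated.\<close>

type_synonym square = "int \<times> int"

definition board :: "nat \<Rightarrow> square set" where
  "board n = {0..<int n} \<times> {0..<int n}"

definition queen_adj :: "square \<Rightarrow> square \<Rightarrow> bool" where
  "queen_adj = (\<lambda>(x, y) (x', y'). (x, y) \<noteq> (x', y') \<and>
     (y = y' \<or> x = x' \<or> y - x = y' - x' \<or> x + y = x' + y'))"

definition queens_domination_number :: "nat \<Rightarrow> nat" (\<open>\<gamma>\<^sub>Q\<close>) where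
  "\<gamma>\<^sub>Q n = domination_number (board n) queen_adj"

definition orthodox_cover :: "nat \<Rightarrow> square set \<Rightarrow> bool" where
  "orthodox_cover n C \<longleftrightarrow> dominating_set (board n) queen_adj C \<and>
     (\<exists>p\<in>{0, 1}. \<exists>q\<in>{0, 1}.
        (\<forall>x\<in>{0..<int n}. x mod 2 = p \<longrightarrow> (\<exists>y. (x, y) \<in> C)) \<and>
        (\<forall>y\<in>{0..<int n}. y mod 2 = q \<longrightarrow> (\<exists>x. (x, y) \<in> C)))"

end

theory Submission
  imports Defs
begin

text \<open>Together the two assertions would give, for every large \<open>n\<close>, an orthodox cover \<open>C\<close> of the
  \<open>n \<times> n\<close> board with \<open>2 * card C \<le> n + 3\<close>. No such cover exists.

  Such a cover is nearly rigid. About \<open>n / 2\<close> queens have to meet every second column and every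
  second row, so all but a bounded number of them, the strays, stand on a column and a row of the
  right parity. A square whose column and row both have the wrong parity has to be covered along a
  diagonal, unless a stray meets its column or row. Modulo 4 the non-stray queens fall into two
  classes, and the class of a queen can be read off from its difference \<open>y - x\<close> as well as from its
  sum \<open>x + y\<close>; for the squares that need a diagonal, the class of the difference is opposite to the
  class of the sum. Hence if a difference at distance \<open>a\<close> from the centre is missing in one
  class, nearly all sums of the opposite class at distance at most \<open>n - 1 - a\<close> are occupied.
  There are just enough queens for this: up to boundedly many exceptions, the differences and the
  sums of one class fill the interval of radius \<open>a\<close> once each, and those of the other class fill
  the interval of radius \<open>n - a\<close> once each (\<open>class_structure\<close>).

  Now rescale the board to the square with coordinates \<open>X, Y\<close> between \<open>-20\<close> and \<open>20\<close>, and put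
  \<open>D = Y - X\<close>, \<open>T = X + Y\<close>. For large \<open>n\<close> the distributions of all four quantities over the queens are
  known: \<open>X\<close> and \<open>Y\<close> are uniform, and \<open>D\<close> and \<open>T\<close> are uniform on the interval of radius \<open>A\<close> for
  the larger class and \<open>B\<close> for the smaller one, where \<open>A + B = 40\<close>. No joint distribution has these
  marginals. The parallelogram law \<open>D\<^sup>2 + T\<^sup>2 = 2 * X\<^sup>2 + 2 * Y\<^sup>2\<close> forces \<open>A\<^sup>3 + B\<^sup>3 = 32000\<close>, that is
  \<open>A = 20 + 20 / sqrt 3\<close>, about \<open>31.547\<close>. Linear programming duality then provides weights \<open>F\<close>
  (\<open>line_weight\<close>) and \<open>G\<close> (\<open>diagonal_weight\<close>) such that every queen satisfies
  \<open>F X + F Y \<le> G D + G T + 195\<close> and \<open>F X + F Y \<le> D\<^sup>2 + T\<^sup>2\<close>. Summing the first inequality over the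
  larger class and the second over the smaller one, and dividing by \<open>n / 80\<close>, gives in the limit
  that four times the integral of \<open>F\<close> over \<open>[0, 20]\<close>, which is \<open>31600 / 3 = 10533.3...\<close>, is at most
  twice the integral of \<open>G\<close> over \<open>[0, A]\<close> plus \<open>2 / 3 * B\<^sup>3 + 195 * A\<close>, which is about \<open>10531.4\<close>. All sums
  are Riemann sums with bounded error while the main terms grow linearly in \<open>n\<close>, so the contradiction
  persists for all large \<open>n\<close>.\<close>

section \<open>Riemann sums over residue classes modulo 4\<close>

text \<open>An even function that increases on the half-line, with a primitive \<open>H\<close> there. Monotonicity makes
the error of a Riemann sum at most one term, whatever the step.\<close>

definition profile :: "(real \<Rightarrow> real) \<Rightarrow> (real \<Rightarrow> real) \<Rightarrow> bool" where
  "profile g H \<longleftrightarrow> H 0 = 0 \<and> (\<forall>u\<ge>0. (H has_real_derivative g u) (at u)) \<and>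
     mono_on {0..} g \<and> 0 \<le> g 0 \<and> (\<forall>u. g (- u) = g u)"

lemma profile_mono: "profile g H \<Longrightarrow> 0 \<le> u \<Longrightarrow> u \<le> v \<Longrightarrow> g u \<le> g v"
  unfolding profile_def by (auto dest!: mono_onD[of _ _ u v])

lemma profile_nonneg: "profile g H \<Longrightarrow> 0 \<le> g u"
proof -
  assume g: "profile g H"
  have "g 0 \<le> g \<bar>u\<bar>" using profile_mono[OF g, of 0 "\<bar>u\<bar>"] by simp
  moreover have "g \<bar>u\<bar> = g u" using g by (auto simp: profile_def abs_if)
  ultimately show ?thesis using g by (auto simp: profile_def)
qed

lemma profile_abs: "profile g H \<Longrightarrow> g \<bar>u\<bar> = g u"
  by (auto simp: profile_def abs_if)

lemma profile_step:
  assumes "profile g H" "0 \<le> u" "u \<le> v"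
  shows "(v - u) * g u \<le> H v - H u" "H v - H u \<le> (v - u) * g v"
proof -
  have "(v - u) * g u \<le> H v - H u \<and> H v - H u \<le> (v - u) * g v"
  proof (cases "u = v")
    case False
    then have "u < v" using assms by simp
    then obtain z where z: "u < z" "z < v" "H v - H u = (v - u) * g z"
      using MVT2[of u v H g] assms by (auto simp: profile_def)
    then show ?thesis
      using profile_mono[OF assms(1), of u z] profile_mono[OF assms(1), of z v] assms
      by (auto intro!: mult_left_mono)
  qed simp
  then show "(v - u) * g u \<le> H v - H u" "H v - H u \<le> (v - u) * g v" by auto
qed

lemma profile_primitive_mono:
  assumes "profile g H" "0 \<le> u" "u \<le> v"
  shows "H u \<le> H v"
  using profile_step(1)[OF assms] profile_nonneg[OF assms(1), of u] assms
    mult_nonneg_nonneg[of "v - u" "g u"] by linarith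

lemma profile_primitive_nonneg: "profile g H \<Longrightarrow> 0 \<le> u \<Longrightarrow> 0 \<le> H u"
  using profile_primitive_mono[of g H 0 u] by (auto simp: profile_def)

text \<open>By monotonicity each summand, times \<open>\<delta>\<close>, lies between the increments of \<open>H\<close> over the two adjacent steps,
and these increments telescope. The points need not start at \<open>0\<close> nor end at \<open>\<rho>\<close>, but they miss either
end by at most one step.\<close>

lemma one_sided_riemann_sum:
  assumes g: "profile g H" and "0 < \<delta>" "0 \<le> u" "u \<le> \<delta>" "0 \<le> \<rho>"
    and lo: "\<rho> < u + \<delta> * real m" and hi: "u + \<delta> * real m \<le> \<rho> + \<delta>"
  shows "\<bar>\<delta> * (\<Sum>j<m. g (u + \<delta> * real j)) - H \<rho>\<bar> \<le> \<delta> * g (\<rho> + \<delta>)"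
proof -
  have up: "\<delta> * (\<Sum>j<k. g (u + \<delta> * real j)) \<le> H (u + \<delta> * real k) - H u" for k
  proof (induction k)
    case (Suc k)
    have "\<delta> * g (u + \<delta> * real k) \<le> H (u + \<delta> * real (Suc k)) - H (u + \<delta> * real k)"
      using profile_step(1)[OF g, of "u + \<delta> * real k" "u + \<delta> * real (Suc k)"] assms(2,3)
      by (simp add: algebra_simps)
    then show ?case using Suc by (simp add: algebra_simps)
  qed simp
  have down: "H (u + \<delta> * real k) \<le> \<delta> * (\<Sum>j<Suc k. g (u + \<delta> * real j))" for k
  proof (induction k)
    case 0
    have "H u \<le> u * g u" using profile_step(2)[OF g, of 0 u] assms(3) g by (simp add: profile_def)
    also have "\<dots> \<le> \<delta> * g u" using assms(4) profile_nonneg[OF g] by (intro mult_right_mono)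
    finally show ?case by simp
  next
    case (Suc k)
    have "H (u + \<delta> * real (Suc k)) - H (u + \<delta> * real k) \<le> \<delta> * g (u + \<delta> * real (Suc k))"
      using profile_step(2)[OF g, of "u + \<delta> * real k" "u + \<delta> * real (Suc k)"] assms(2,3)
      by (simp add: algebra_simps)
    then show ?case using Suc by (simp add: algebra_simps)
  qed
  have mono: "g \<rho> \<le> g (\<rho> + \<delta>)" using profile_mono[OF g] assms by simp
  have "\<delta> * (\<Sum>j<m. g (u + \<delta> * real j)) \<le> H (u + \<delta> * real m) - H u" by (rule up)
  also have "\<dots> \<le> H (\<rho> + \<delta>)"
    using profile_primitive_mono[OF g _ hi] profile_primitive_nonneg[OF g, of u] assms by simp
  also have "\<dots> \<le> H \<rho> + \<delta> * g (\<rho> + \<delta>)"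
    using profile_step(2)[OF g, of \<rho> "\<rho> + \<delta>"] assms by simp
  finally have 1: "\<delta> * (\<Sum>j<m. g (u + \<delta> * real j)) - H \<rho> \<le> \<delta> * g (\<rho> + \<delta>)" by simp
  have 2: "H \<rho> - \<delta> * (\<Sum>j<m. g (u + \<delta> * real j)) \<le> \<delta> * g (\<rho> + \<delta>)"
  proof (cases m)
    case 0
    have "H \<rho> \<le> \<rho> * g \<rho>" using profile_step(2)[OF g, of 0 \<rho>] assms g by (simp add: profile_def)
    also have "\<dots> \<le> \<delta> * g (\<rho> + \<delta>)"
      using 0 lo assms mono profile_nonneg[OF g] by (intro mult_mono) auto
    finally show ?thesis using 0 by simp
  next
    case (Suc k)
    let ?v = "u + \<delta> * real k"
    have v: "0 \<le> ?v" "?v \<le> \<rho>" "\<rho> - ?v \<le> \<delta>"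
      using assms Suc by (auto simp: algebra_simps)
    have "H \<rho> - H ?v \<le> (\<rho> - ?v) * g \<rho>" using profile_step(2)[OF g v(1,2)] .
    also have "\<dots> \<le> \<delta> * g (\<rho> + \<delta>)"
      using v mono profile_nonneg[OF g] assms by (intro mult_mono) auto
    finally show ?thesis using down[of k] Suc by simp
  qed
  from 1 2 show ?thesis by linarith
qed

definition progression :: "int \<Rightarrow> int \<Rightarrow> int set" where
  "progression r R = {k. \<bar>k\<bar> \<le> R \<and> k mod 4 = r mod 4}"

lemma finite_progression [simp]: "finite (progression r R)"
  by (rule finite_subset[of _ "{-R..R}"]) (auto simp: progression_def)

text \<open>The points \<open>k \<ge> 0\<close> and the points \<open>k < 0\<close> form one arithmetic progression each, with
first terms \<open>r mod 4\<close> and \<open>r mod 4 - 4\<close>; evenness turns the second into a sum over positive points.\<close>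

lemma progression_riemann_sum:
  assumes g: "profile g H" and "0 \<le> R" "0 < l"
  shows "\<bar>4 * l * (\<Sum>k\<in>progression r R. g (l * of_int k)) - 2 * H (l * of_int R)\<bar>
    \<le> 8 * l * g (l * of_int (R + 4))"
proof -
  define k0 k1 where "k0 = r mod 4" and "k1 = 4 - k0"
  define m0 m1 where "m0 = nat ((R - k0) div 4 + 1)" and "m1 = nat ((R - k1) div 4 + 1)"
  have k: "0 \<le> k0" "k0 < 4" "0 < k1" "k1 \<le> 4" by (auto simp: k0_def k1_def)
  have m0: "R < k0 + 4 * int m0" "k0 + 4 * int m0 \<le> R + 4"
    using k assms unfolding m0_def by linarith+
  have m1: "R < k1 + 4 * int m1" "k1 + 4 * int m1 \<le> R + 4"
    using k assms unfolding m1_def by linarith+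
  let ?P = "(\<lambda>j. k0 + 4 * int j) ` {..<m0}" and ?N = "(\<lambda>j. - (k1 + 4 * int j)) ` {..<m1}"
  have split: "progression r R = ?P \<union> ?N"
  proof (intro set_eqI iffI)
    fix x assume x: "x \<in> progression r R"
    show "x \<in> ?P \<union> ?N"
    proof -
      have x4: "x = k0 + 4 * (x div 4)"
        using x by (simp add: progression_def k0_def) presburger
      show ?thesis
      proof (cases "0 \<le> x")
        case True
        have "4 * (x div 4) < 4 * int m0" using x x4 m0 by (auto simp: progression_def)
        then have "nat (x div 4) < m0" using True by linarith
        moreover have "x = k0 + 4 * int (nat (x div 4))" using x4 True by simp
        ultimately show ?thesis by blast
      next
        case False
        then have neg: "0 \<le> - 1 - x div 4" by simp
        have "x = - (k1 + 4 * (- 1 - x div 4))" using x4 by (simp add: k1_def)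
        moreover from this have "4 * (- 1 - x div 4) < 4 * int m1"
          using x m1 unfolding progression_def by (simp add: abs_le_iff)
        ultimately have "nat (- 1 - x div 4) < m1" "x = - (k1 + 4 * int (nat (- 1 - x div 4)))"
          using neg by (simp_all add: nat_less_iff)
        then show ?thesis by blast
      qed
    qed
  next
    fix x assume "x \<in> ?P \<union> ?N"
    then show "x \<in> progression r R"
    proof
      assume "x \<in> ?P"
      then obtain j where "x = k0 + 4 * int j" "j < m0" by auto
      then show ?thesis using m0 k by (auto simp: progression_def k0_def)
    next
      assume "x \<in> ?N"
      then obtain j where j: "x = - (k1 + 4 * int j)" "j < m1" by auto
      then have "x = k0 + 4 * (- 1 - int j)" by (simp add: k1_def)
      then have "x mod 4 = r mod 4" by (simp add: k0_def) presburger
      then show ?thesis using j m1 k by (auto simp: progression_def)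
    qed
  qed
  have "(\<Sum>k\<in>progression r R. g (l * of_int k))
      = (\<Sum>k\<in>?P. g (l * of_int k)) + (\<Sum>k\<in>?N. g (l * of_int k))"
    unfolding split using k by (intro sum.union_disjoint) auto
  also have "(\<Sum>k\<in>?P. g (l * of_int k)) = (\<Sum>j<m0. g (l * of_int k0 + 4 * l * real j))"
    by (subst sum.reindex) (auto simp: inj_on_def algebra_simps)
  also have "(\<Sum>k\<in>?N. g (l * of_int k)) = (\<Sum>j<m1. g (- (l * of_int k1 + 4 * l * real j)))"
    by (subst sum.reindex) (auto simp: inj_on_def algebra_simps)
  also have "\<dots> = (\<Sum>j<m1. g (l * of_int k1 + 4 * l * real j))"
    using g unfolding profile_def by metis
  finally have sum: "(\<Sum>k\<in>progression r R. g (l * of_int k))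
    = (\<Sum>j<m0. g (l * of_int k0 + 4 * l * real j)) + (\<Sum>j<m1. g (l * of_int k1 + 4 * l * real j))" .
  have one: "\<bar>4 * l * (\<Sum>j<m. g (l * of_int k + 4 * l * real j)) - H (l * of_int R)\<bar>
      \<le> 4 * l * g (l * of_int (R + 4))"
    if "0 \<le> k" "k \<le> 4" "R < k + 4 * int m" "k + 4 * int m \<le> R + 4" for k :: int and m
  proof -
    have r: "of_int R < of_int k + 4 * real m" "of_int k + 4 * real m \<le> (of_int R :: real) + 4"
      using that(3,4) by linarith+
    have "l * of_int R < l * (of_int k + 4 * real m)" "l * (of_int k + 4 * real m) \<le> l * (of_int R + 4)"
      using r assms by (auto intro!: mult_left_mono mult_strict_left_mono)
    then show ?thesis
      using one_sided_riemann_sum[OF g, of "4 * l" "l * of_int k" "l * of_int R" m] that assms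
      by (simp add: algebra_simps)
  qed
  have "\<bar>4 * l * (\<Sum>j<m0. g (l * of_int k0 + 4 * l * real j)) - H (l * of_int R)\<bar>
      \<le> 4 * l * g (l * of_int (R + 4))"
    using k m0 by (intro one) auto
  moreover have "\<bar>4 * l * (\<Sum>j<m1. g (l * of_int k1 + 4 * l * real j)) - H (l * of_int R)\<bar>
      \<le> 4 * l * g (l * of_int (R + 4))"
    using k m1 by (intro one) auto
  ultimately show ?thesis unfolding sum distrib_left by linarith
qed

lemma card_progression:
  assumes "0 \<le> R"
  shows "\<bar>real (card (progression r R)) - of_int R / 2\<bar> \<le> 2"
proof -
  \<comment> \<open>Counting is summing the constant weight \<open>1\<close>.\<close>
  have "profile (\<lambda>_. 1) (\<lambda>u. u)"
    unfolding profile_def by (auto intro!: derivative_eq_intros mono_onI)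
  from progression_riemann_sum[OF this assms, of 1 r] show ?thesis by simp
qed

text \<open>Up to \<open>K\<close> exceptions, the multiset of values of \<open>f\<close> on \<open>Q\<close> is the progression. Once nearly all points are
hit, the bound on \<open>card Q\<close> limits both repetitions and values outside.\<close>

definition fills :: "'a set \<Rightarrow> ('a \<Rightarrow> int) \<Rightarrow> int \<Rightarrow> int \<Rightarrow> nat \<Rightarrow> bool" where
  "fills Q f r R K \<longleftrightarrow> finite Q \<and> card (progression r R - f ` Q) \<le> K \<and>
     card Q \<le> card (progression r R) + K"

lemma sum_le_card_bound:
  fixes h :: "'a \<Rightarrow> real"
  assumes "card S \<le> m" "\<And>k. k \<in> S \<Longrightarrow> h k \<le> M" "0 \<le> M"
  shows "(\<Sum>k\<in>S. h k) \<le> real m * M"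
proof -
  have "(\<Sum>k\<in>S. h k) \<le> of_nat (card S) * M" using assms(2) by (intro sum_bounded_above)
  also have "\<dots> \<le> real m * M" using assms(1,3) by (intro mult_right_mono) auto
  finally show ?thesis .
qed

text \<open>Choose one element of \<open>Q\<close> over each value that is hit. By the cardinality condition at most
\<open>2 * K\<close> elements of \<open>Q\<close> and at most \<open>K\<close> points of the progression are then left over, each
contributing between \<open>0\<close> and \<open>M\<close>.\<close>

lemma fills_sum:
  fixes g :: "int \<Rightarrow> real"
  assumes Q: "fills Q f r R K"
    and g: "\<And>k. 0 \<le> g k" "\<And>k. k \<in> progression r R \<union> f ` Q \<Longrightarrow> g k \<le> M"
    and M: "0 \<le> M"
  shows "\<bar>(\<Sum>c\<in>Q. g (f c)) - (\<Sum>k\<in>progression r R. g k)\<bar> \<le> 2 * real K * M"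
proof -
  have fin: "finite Q" using Q by (simp add: fills_def)
  let ?Z = "progression r R"
  have "?Z \<inter> f ` Q \<subseteq> f ` Q" by blast
  then obtain T where "T \<subseteq> Q \<and> inj_on f T \<and> ?Z \<inter> f ` Q = f ` T"
    unfolding subset_image_inj by blast
  then have T: "T \<subseteq> Q" "inj_on f T" "f ` T = ?Z \<inter> f ` Q" by simp_all
  have cardT: "card T = card (?Z \<inter> f ` Q)" using T card_image by metis
  have cardZ: "card ?Z = card (?Z \<inter> f ` Q) + card (?Z - f ` Q)"
    by (simp add: card_Int_Diff)
  have cardQ: "card (Q - T) = card Q - card T"
    using T fin by (simp add: card_Diff_subset finite_subset)
  have rest: "card (Q - T) \<le> 2 * K" using Q cardT cardZ cardQ unfolding fills_def by linarith
  have sT: "(\<Sum>c\<in>T. g (f c)) = (\<Sum>k\<in>?Z \<inter> f ` Q. g k)"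
    using T by (metis (no_types, lifting) sum.reindex_cong)
  have sQ: "(\<Sum>c\<in>Q. g (f c)) = (\<Sum>c\<in>T. g (f c)) + (\<Sum>c\<in>Q - T. g (f c))"
    using sum.subset_diff[OF T(1) fin, of "\<lambda>c. g (f c)"] by simp
  have sZ: "(\<Sum>k\<in>?Z. g k) = (\<Sum>k\<in>?Z \<inter> f ` Q. g k) + (\<Sum>k\<in>?Z - f ` Q. g k)"
    by (rule sum.Int_Diff) simp
  have "(\<Sum>c\<in>Q - T. g (f c)) \<le> real (2 * K) * M"
    using rest g M by (intro sum_le_card_bound) auto
  moreover have "(\<Sum>k\<in>?Z - f ` Q. g k) \<le> real (2 * K) * M"
    using Q g M by (intro sum_le_card_bound) (auto simp: fills_def)
  moreover have "0 \<le> (\<Sum>c\<in>Q - T. g (f c))" "0 \<le> (\<Sum>k\<in>?Z - f ` Q. g k)"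
    using g by (auto intro: sum_nonneg)
  ultimately show ?thesis unfolding sQ sZ sT by simp
qed

text \<open>The real number \<open>\<rho>\<close> may replace the integer radius \<open>R\<close>, so that families with slightly different
radii can be estimated by one and the same integral. With \<open>K = 80\<close>, the exceptions cost \<open>160 * M\<close>, the
Riemann sum \<open>2 * M\<close> and the change of radius \<open>40 * M\<close>.\<close>

lemma fills_riemann_sum:
  assumes Q: "fills Q f r R 80" and g: "profile g H" and l: "0 < l" and R: "0 \<le> R"
    and \<rho>: "0 \<le> \<rho>" "\<bar>of_int R - \<rho>\<bar> \<le> 80"
    and U: "l * (of_int R + 4) \<le> U" "l * \<rho> \<le> U" "\<And>c. c \<in> Q \<Longrightarrow> \<bar>l * of_int (f c)\<bar> \<le> U"
    and M: "g U \<le> M"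
  shows "\<bar>(\<Sum>c\<in>Q. g (l * of_int (f c))) - H (l * \<rho>) / (2 * l)\<bar> \<le> 300 * M"
proof -
  have lR: "0 \<le> l * of_int R" using l R by simp
  have U0: "0 \<le> U" using lR l U(1) by (simp add: algebra_simps)
  have gM: "g u \<le> M" if "\<bar>u\<bar> \<le> U" for u
    using profile_mono[OF g, of "\<bar>u\<bar>" U] profile_abs[OF g, of u] that M by simp
  have M0: "0 \<le> M" using profile_nonneg[OF g, of U] M by simp
  let ?Z = "\<Sum>k\<in>progression r R. g (l * of_int k)"
  have 1: "\<bar>(\<Sum>c\<in>Q. g (l * of_int (f c))) - ?Z\<bar> \<le> 2 * real 80 * M"
  proof (rule fills_sum[OF Q])
    fix k assume k: "k \<in> progression r R \<union> f ` Q"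
    have "\<bar>l * of_int k\<bar> \<le> U"
    proof (cases "k \<in> f ` Q")
      case False
      then have "\<bar>k\<bar> \<le> R" using k by (auto simp: progression_def)
      then have "\<bar>of_int k :: real\<bar> \<le> of_int R + 4" by linarith
      then have "l * \<bar>of_int k\<bar> \<le> l * (of_int R + 4)" using l by (intro mult_left_mono) auto
      then have "l * \<bar>of_int k\<bar> \<le> U" using U(1) by (rule order_trans)
      then show ?thesis using l by (simp add: abs_mult)
    qed (use U(3) in auto)
    then show "g (l * of_int k) \<le> M" by (rule gM)
  qed (use M0 profile_nonneg[OF g] in auto)
  have 2: "\<bar>?Z - H (l * of_int R) / (2 * l)\<bar> \<le> 2 * M"
  proof -
    have "g (l * of_int (R + 4)) \<le> M" using U(1) lR l by (intro gM) (auto simp: algebra_simps)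
    then have "8 * l * g (l * of_int (R + 4)) \<le> 8 * l * M" using l by simp
    then have "\<bar>4 * l * ?Z - 2 * H (l * of_int R)\<bar> \<le> 8 * l * M"
      using progression_riemann_sum[OF g R l, of r] by linarith
    moreover have "4 * l * ?Z - 2 * H (l * of_int R) = 4 * l * (?Z - H (l * of_int R) / (2 * l))"
      using l by (simp add: field_simps)
    ultimately have "4 * l * \<bar>?Z - H (l * of_int R) / (2 * l)\<bar> \<le> 4 * l * (2 * M)"
      using l by (simp add: abs_mult)
    then show ?thesis using l by (subst (asm) mult_le_cancel_left_pos) auto
  qed
  have 3: "\<bar>H (l * of_int R) - H (l * \<rho>)\<bar> \<le> 80 * l * M"
  proof -
    have *: "\<bar>H (l * v) - H (l * u)\<bar> \<le> 80 * l * M" if "0 \<le> u" "u \<le> v" "v - u \<le> 80" "l * v \<le> U" for u v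
    proof -
      have uv: "0 \<le> l * u" "l * u \<le> l * v" using that l by auto
      have "H (l * v) - H (l * u) \<le> (l * v - l * u) * g (l * v)" by (rule profile_step(2)[OF g uv])
      also have "\<dots> = l * (v - u) * g (l * v)" by (simp add: algebra_simps)
      also have "\<dots> \<le> l * 80 * M"
        using that l uv gM profile_nonneg[OF g] by (intro mult_mono mult_nonneg_nonneg) auto
      finally show ?thesis using profile_primitive_mono[OF g uv] by (simp add: mult_ac)
    qed
    have "l * of_int R \<le> U" using U(1) l by (simp add: algebra_simps)
    then show ?thesis
      using *[of \<rho> "of_int R"] *[of "of_int R" \<rho>] \<rho> U R by (cases "\<rho> \<le> of_int R") (auto simp: abs_minus_commute)
  qed
  have "\<bar>H (l * of_int R) / (2 * l) - H (l * \<rho>) / (2 * l)\<bar> \<le> 40 * M"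
  proof -
    have "\<bar>H (l * of_int R) / (2 * l) - H (l * \<rho>) / (2 * l)\<bar> = \<bar>H (l * of_int R) - H (l * \<rho>)\<bar> / (2 * l)"
      using l by (simp add: diff_divide_distrib[symmetric])
    also have "\<dots> \<le> 80 * l * M / (2 * l)" using 3 l by (intro divide_right_mono) auto
    finally show ?thesis using l by simp
  qed
  then show ?thesis using 1 2 M0 by linarith
qed

section \<open>A linear programming certificate\<close>

definition ramp :: "real \<Rightarrow> real" where
  "ramp u = max 0 u"

text \<open>The exponent is at least \<open>2\<close> so that the kink at \<open>a\<close> is smoothed out: there the difference quotient
is bounded by \<open>\<bar>h\<bar> ^ (k - 1)\<close>.\<close>

lemma DERIV_ramp_power:
  assumes "2 \<le> k"
  shows "((\<lambda>u. ramp (u - a) ^ k) has_real_derivative real k * ramp (u - a) ^ (k - 1)) (at u)"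
proof -
  consider "u < a" | "u > a" | "u = a" by linarith
  then show ?thesis
  proof cases
    case 1
    have "((\<lambda>u. 0) has_real_derivative real k * ramp (u - a) ^ (k - 1)) (at u)"
      using 1 assms by (simp add: ramp_def power_0_left)
    then show ?thesis
      by (rule has_field_derivative_transform_within_open[where S = "{..<a}"])
        (use 1 assms in \<open>auto simp: ramp_def\<close>)
  next
    case 2
    have "((\<lambda>u. (u - a) ^ k) has_real_derivative real k * ramp (u - a) ^ (k - 1)) (at u)"
      using 2 by (auto intro!: derivative_eq_intros simp: ramp_def)
    then show ?thesis
      by (rule has_field_derivative_transform_within_open[where S = "{a<..}"])
        (use 2 in \<open>auto simp: ramp_def\<close>)
  next
    case 3
    have "((\<lambda>h. ramp h ^ k / h) \<longlongrightarrow> 0) (at 0)"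
    proof (rule tendsto_rabs_zero_cancel, rule tendsto_sandwich[OF _ _ tendsto_const])
      show "\<forall>\<^sub>F h in at 0. \<bar>ramp h ^ k / h\<bar> \<le> \<bar>h\<bar> ^ (k - 1)"
      proof (rule always_eventually, rule allI)
        fix h :: real
        have "ramp h ^ k / h = (if h > 0 then h ^ (k - 1) else 0)"
          using assms by (auto simp: ramp_def max_def power_eq_if)
        then show "\<bar>ramp h ^ k / h\<bar> \<le> \<bar>h\<bar> ^ (k - 1)" by simp
      qed
      have "((\<lambda>h::real. \<bar>h\<bar> ^ (k - 1)) \<longlongrightarrow> \<bar>0\<bar> ^ (k - 1)) (at 0)"
        by (intro tendsto_intros)
      then show "((\<lambda>h::real. \<bar>h\<bar> ^ (k - 1)) \<longlongrightarrow> 0) (at 0)"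
        using assms by (simp only: abs_zero power_0_left) (simp split: if_splits)
    qed auto
    then show ?thesis using 3 assms by (simp add: DERIV_def ramp_def power_0_left)
  qed
qed

lemmas DERIV_ramp_square = DERIV_ramp_power[of 2, simplified]
lemmas DERIV_ramp_cube = DERIV_ramp_power[of 3, simplified]

text \<open>The two weights are a rounded optimal solution of the linear program dual to the existence of a
joint distribution of \<open>X, Y, D, T\<close> with the marginals described above. The line weight is \<open>2 * u\<^sup>2\<close> up to \<open>5\<close>
and has slope \<open>16\<close> beyond; the diagonal weight vanishes up to \<open>12\<close>, is \<open>(\<bar>u\<bar> - 12)\<^sup>2\<close> up to \<open>19\<close> and
has slope \<open>16\<close> beyond. Equality of the two outer slopes makes \<open>F X + F Y\<close> and \<open>G T\<close> grow at the same
rate in the corners of the board, where \<open>X\<close> and \<open>Y\<close> are both large.\<close>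

definition line_weight :: "real \<Rightarrow> real" where
  "line_weight u = 2 * u\<^sup>2 - 2 * (ramp (\<bar>u\<bar> - 5))\<^sup>2 - 4 * ramp (\<bar>u\<bar> - 5)"

definition diagonal_weight :: "real \<Rightarrow> real" where
  "diagonal_weight u = (ramp (\<bar>u\<bar> - 12))\<^sup>2 - (ramp (\<bar>u\<bar> - 19))\<^sup>2 + 2 * ramp (\<bar>u\<bar> - 19)"

definition line_integral :: "real \<Rightarrow> real" where
  "line_integral u = 2 / 3 * u ^ 3 - 2 / 3 * ramp (u - 5) ^ 3 - 2 * (ramp (u - 5))\<^sup>2"

definition diagonal_integral :: "real \<Rightarrow> real" where
  "diagonal_integral u = 1 / 3 * ramp (u - 12) ^ 3 - 1 / 3 * ramp (u - 19) ^ 3 + (ramp (u - 19))\<^sup>2"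

lemma line_weight_simps:
  "\<bar>u\<bar> \<le> 5 \<Longrightarrow> line_weight u = 2 * u\<^sup>2"
  "5 \<le> \<bar>u\<bar> \<Longrightarrow> line_weight u = 16 * \<bar>u\<bar> - 30"
   apply (simp add: line_weight_def ramp_def)
  apply (simp add: line_weight_def ramp_def power2_diff)
  done

lemma diagonal_weight_simps:
  "\<bar>u\<bar> \<le> 12 \<Longrightarrow> diagonal_weight u = 0"
  "12 \<le> \<bar>u\<bar> \<Longrightarrow> \<bar>u\<bar> \<le> 19 \<Longrightarrow> diagonal_weight u = (\<bar>u\<bar> - 12)\<^sup>2"
  "19 \<le> \<bar>u\<bar> \<Longrightarrow> diagonal_weight u = 16 * \<bar>u\<bar> - 255"
    apply (simp add: diagonal_weight_def ramp_def)
   apply (simp add: diagonal_weight_def ramp_def)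
  apply (simp add: diagonal_weight_def ramp_def power2_diff)
  done

lemma profile_line_weight: "profile line_weight line_integral"
  unfolding profile_def
proof (intro conjI allI impI)
  fix u :: real assume u: "0 \<le> u"
  have "(line_integral has_real_derivative
      2 / 3 * (3 * u\<^sup>2) - 2 / 3 * (3 * (ramp (u - 5))\<^sup>2) - 2 * (2 * ramp (u - 5))) (at u)"
    unfolding line_integral_def[abs_def]
    by (intro DERIV_diff DERIV_cmult DERIV_ramp_square DERIV_ramp_cube)
      (auto intro!: derivative_eq_intros)
  then show "(line_integral has_real_derivative line_weight u) (at u)"
    using u by (simp add: line_weight_def)
next
  show "mono_on {0..} line_weight"
  proof (rule mono_onI)
    fix u v :: real assume uv: "u \<in> {0..}" "v \<in> {0..}" "u \<le> v"
    have sq: "x\<^sup>2 \<le> y\<^sup>2" if "0 \<le> x" "x \<le> y" for x y :: real using that by (intro power_mono)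
    show "line_weight u \<le> line_weight v"
      using uv sq[of u v] sq[of u 5]
      by (cases "u \<le> 5"; cases "v \<le> 5") (auto simp: line_weight_simps)
  qed
qed (auto simp: line_weight_def line_integral_def ramp_def)

lemma profile_diagonal_weight: "profile diagonal_weight diagonal_integral"
  unfolding profile_def
proof (intro conjI allI impI)
  fix u :: real assume u: "0 \<le> u"
  have "(diagonal_integral has_real_derivative
      1 / 3 * (3 * (ramp (u - 12))\<^sup>2) - 1 / 3 * (3 * (ramp (u - 19))\<^sup>2)
        + 2 * ramp (u - 19)) (at u)"
    unfolding diagonal_integral_def[abs_def]
    by (intro DERIV_add DERIV_diff DERIV_cmult DERIV_ramp_square DERIV_ramp_cube)
  then show "(diagonal_integral has_real_derivative diagonal_weight u) (at u)"
    using u by (simp add: diagonal_weight_def)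
next
  show "mono_on {0..} diagonal_weight"
  proof (rule mono_onI)
    fix u v :: real assume uv: "u \<in> {0..}" "v \<in> {0..}" "u \<le> v"
    have sq: "(x - 12)\<^sup>2 \<le> (y - 12)\<^sup>2" if "12 \<le> x" "x \<le> y" for x y :: real
      using that by (intro power_mono) auto
    consider "v \<le> 12" | "u \<le> 12" "12 \<le> v" "v \<le> 19" | "u \<le> 12" "19 \<le> v"
      | "12 \<le> u" "v \<le> 19" | "12 \<le> u" "u \<le> 19" "19 \<le> v" | "19 \<le> u"
      by linarith
    then show "diagonal_weight u \<le> diagonal_weight v"
      using uv sq[of u v] sq[of u 19]
      by cases (auto simp: diagonal_weight_simps)
  qed
qed (auto simp: diagonal_weight_def diagonal_integral_def ramp_def)

lemma profile_square: "profile (\<lambda>u. u\<^sup>2) (\<lambda>u. u ^ 3 / 3)"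
  unfolding profile_def
  by (auto intro!: derivative_eq_intros mono_onI power_mono)

lemma line_weight_le_square: "line_weight u \<le> 2 * u\<^sup>2"
proof -
  have "0 \<le> ramp (\<bar>u\<bar> - 5)" by (simp add: ramp_def)
  moreover have "0 \<le> (ramp (\<bar>u\<bar> - 5))\<^sup>2" by simp
  ultimately show ?thesis unfolding line_weight_def by linarith
qed

text \<open>If both coordinates are at least \<open>3\<close>, the linear bounds \<open>16 * u - 30\<close> from above and \<open>16 * u - 255\<close> from
below suffice, with equality when \<open>x\<close> and \<open>y\<close> exceed \<open>5\<close>, \<open>x + y\<close> exceeds \<open>19\<close> and \<open>x - y\<close> is less than \<open>12\<close>.
For \<open>y < 3\<close> the critical regions are those where \<open>x - y\<close> or \<open>x + y\<close> lies between \<open>12\<close> and \<open>19\<close>; there the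
right-hand side exceeds the left one by at least \<open>1\<close> plus a square.\<close>

lemma line_weight_le_diagonal_weight_ordered:
  assumes "0 \<le> y" "y \<le> x"
  shows "line_weight x + line_weight y \<le> diagonal_weight (x - y) + diagonal_weight (x + y) + 195"
proof -
  have tangent: "16 * u - 255 \<le> diagonal_weight u" if "0 \<le> u" for u
  proof -
    consider "u \<le> 12" | "12 \<le> u" "u \<le> 19" | "19 \<le> u" by linarith
    then show ?thesis
    proof cases
      case 2
      have "(u - 12)\<^sup>2 - (16 * u - 255) = (u - 20)\<^sup>2 - 1" by (simp add: power2_eq_square algebra_simps)
      moreover have "1 \<le> (u - 20)\<^sup>2" using 2 power_mono[of 1 "20 - u" 2] by (simp add: power2_commute)
      ultimately show ?thesis using 2 by (simp add: diagonal_weight_simps)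
    qed (use that in \<open>auto simp: diagonal_weight_simps\<close>)
  qed
  have chord: "line_weight u \<le> 16 * u - 30" if "3 \<le> u" for u
  proof (cases "u \<le> 5")
    case True
    have "2 * u\<^sup>2 - (16 * u - 30) = 2 * ((u - 3) * (u - 5))" by (simp add: power2_eq_square algebra_simps)
    moreover have "(u - 3) * (u - 5) \<le> 0" using that True by (simp add: mult_nonneg_nonpos)
    ultimately show ?thesis using True that by (simp add: line_weight_simps)
  qed (use that in \<open>simp add: line_weight_simps\<close>)
  have nonneg: "0 \<le> diagonal_weight u" for u by (rule profile_nonneg[OF profile_diagonal_weight])
  have sq9: "u\<^sup>2 \<le> 9" if "0 \<le> u" "u \<le> 3" for u :: real using power_mono[of u 3 2] that by simp
  consider "3 \<le> y" | "x \<le> 3" | "y < 3" "3 < x" by linarith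
  then show ?thesis
  proof cases
    case 1
    then show ?thesis using chord[of x] chord[of y] tangent[of "x + y"] nonneg[of "x - y"] assms by simp
  next
    case 2
    then show ?thesis
      using sq9[of x] sq9[of y] assms nonneg[of "x - y"] nonneg[of "x + y"]
      by (simp add: line_weight_simps)
  next
    case 3
    have lx: "line_weight x \<le> 16 * x - 30" using 3 by (intro chord) simp
    have ly: "line_weight y = 2 * y\<^sup>2" using 3 assms by (simp add: line_weight_simps)
    have ly9: "y\<^sup>2 \<le> 9" using 3 assms by (intro sq9) auto
    have "16 * x - 225 + 2 * y\<^sup>2 \<le> diagonal_weight (x - y) + diagonal_weight (x + y)"
    proof -
      consider "19 \<le> x - y" | "12 \<le> x - y" "x - y \<le> 19" "x + y \<le> 19"
        | "12 \<le> x - y" "x - y \<le> 19" "19 < x + y"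
        | "x - y \<le> 12" "x + y \<le> 12" | "x - y \<le> 12" "12 \<le> x + y"
        by linarith
      then show ?thesis
      proof cases
        case 1
        then show ?thesis using assms ly9 by (simp add: diagonal_weight_simps)
      next
        case 2
        have "(x - y - 12)\<^sup>2 + (x + y - 12)\<^sup>2 = 16 * x - 225 + 2 * y\<^sup>2 + (2 * (x - 16)\<^sup>2 + 1)"
          by (simp add: power2_eq_square algebra_simps)
        then show ?thesis using 2 assms by (simp add: diagonal_weight_simps)
      next
        case case3: 3
        have "(7 - 2 * y)\<^sup>2 \<le> (x - y - 12)\<^sup>2" using case3 3 by (intro power_mono) auto
        moreover have "(7 - 2 * y)\<^sup>2 = 2 * (y - 3)\<^sup>2 + 1 + 2 * y\<^sup>2 - 16 * y + 30"
          by (simp add: power2_eq_square algebra_simps)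
        moreover have "0 \<le> 2 * (y - 3)\<^sup>2" by simp
        ultimately have "16 * x - 225 + 2 * y\<^sup>2 \<le> (x - y - 12)\<^sup>2 + (16 * (x + y) - 255)" by argo
        then show ?thesis using case3 assms by (simp add: diagonal_weight_simps)
      next
        case 4
        then show ?thesis using nonneg[of "x - y"] nonneg[of "x + y"] ly9 assms by simp
      next
        case 5
        have "(x + y - 12)\<^sup>2 - (16 * x - 225 + 2 * y\<^sup>2)
            = (12 + y - x) * (28 - 3 * y - x) + (2 * (y - 4)\<^sup>2 + 1)"
          by (simp add: power2_eq_square algebra_simps)
        moreover have "0 \<le> (12 + y - x) * (28 - 3 * y - x)"
          using 5 3 by (intro mult_nonneg_nonneg) auto
        moreover have "0 \<le> 2 * (y - 4)\<^sup>2" by simp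
        ultimately have "16 * x - 225 + 2 * y\<^sup>2 \<le> (x + y - 12)\<^sup>2" by argo
        then show ?thesis using 5 3 assms nonneg[of "x - y"] by (simp add: diagonal_weight_simps)
      qed
    qed
    then show ?thesis using lx ly by simp
  qed
qed

text \<open>All weights are even, and replacing \<open>x, y\<close> by the smaller and the larger absolute value merely
permutes \<open>\<bar>y - x\<bar>\<close> and \<open>\<bar>x + y\<bar>\<close>.\<close>

lemma line_weight_le_diagonal_weight:
  "line_weight x + line_weight y \<le> diagonal_weight (y - x) + diagonal_weight (x + y) + 195"
proof -
  have even: "line_weight \<bar>u\<bar> = line_weight u" "diagonal_weight \<bar>u\<bar> = diagonal_weight u" for u
    by (auto simp: line_weight_def diagonal_weight_def)
  define b a where "b = max \<bar>x\<bar> \<bar>y\<bar>" and "a = min \<bar>x\<bar> \<bar>y\<bar>"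
  have "{b - a, b + a} = {\<bar>y - x\<bar>, \<bar>x + y\<bar>}" "b - a = \<bar>x + y\<bar> \<and> b + a = \<bar>y - x\<bar> \<or>
      b - a = \<bar>y - x\<bar> \<and> b + a = \<bar>x + y\<bar>"
    by (auto simp: a_def b_def abs_if max_def min_def)
  then have "diagonal_weight (b - a) + diagonal_weight (b + a)
      = diagonal_weight (y - x) + diagonal_weight (x + y)"
    by (auto simp: even)
  moreover have "line_weight b + line_weight a = line_weight x + line_weight y"
    by (auto simp: a_def b_def max_def min_def even)
  moreover have "line_weight b + line_weight a
      \<le> diagonal_weight (b - a) + diagonal_weight (b + a) + 195"
    by (rule line_weight_le_diagonal_weight_ordered) (auto simp: a_def b_def)
  ultimately show ?thesis by linarith
qed

text \<open>For \<open>A + B = 40\<close> and \<open>A \<ge> B\<close> the sum of the cubes increases with \<open>A\<close>, so \<open>cubes\<close> bounds \<open>A\<close> by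
\<open>31.549\<close>. On the remaining range the right-hand side of \<open>cert\<close> is a convex function of \<open>A\<close>, so
it is below the larger of its values at the end points, which is less than \<open>10532.7\<close>.\<close>

lemma certificate_contradiction:
  fixes A B :: real
  assumes B: "0 \<le> B" "B \<le> A" and sum: "\<bar>A + B - 40\<bar> \<le> 1 / 10 ^ 6"
    and cubes: "A ^ 3 + B ^ 3 \<le> 32000 + 1 / 100"
    and cert: "4 * line_integral 20 \<le> 2 * diagonal_integral A + 2 / 3 * B ^ 3 + 195 * A + 1 / 100"
  shows False
proof -
  define s where "s = A + B"
  have s: "39.999999 \<le> s" "s \<le> 40.000001" using sum unfolding s_def abs_le_iff by simp_all
  then have A19: "19.999 \<le> A" using B by (simp add: s_def)
  have A31: "A \<le> 31.549"
  proof (rule ccontr)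
    assume "\<not> A \<le> 31.549"
    then have A: "31.549 \<le> A" by simp
    have "A ^ 3 + B ^ 3 = s * (s\<^sup>2 - 3 * (A * B))"
      by (simp add: s_def power2_eq_square power3_eq_cube algebra_simps)
    moreover have AB: "A * B \<le> 31.549 * 8.451001"
    proof -
      have "A * B \<le> A * (40.000001 - A)" using B s A19 by (intro mult_left_mono) (auto simp: s_def)
      also have "\<dots> = 31.549 * 8.451001 - (A - 31.549) * (A - 8.451001)" by (simp add: field_simps)
      also have "\<dots> \<le> 31.549 * 8.451001" using A by simp
      finally show ?thesis .
    qed
    moreover have s2: "39.999999\<^sup>2 \<le> s\<^sup>2" using s by (intro power_mono) auto
    have "39.999999 * (39.999999\<^sup>2 - 3 * (31.549 * 8.451001)) \<le> s * (s\<^sup>2 - 3 * (A * B))"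
      using AB s2 s by (intro mult_mono) (linarith | simp add: power2_eq_square)+
    ultimately show False using cubes by (simp add: power2_eq_square)
  qed
  \<comment> \<open>Bounding \<open>B\<close> by \<open>u\<close> makes the right-hand side of \<open>cert\<close> a cubic in \<open>A\<close>. The cubic term is
    replaced by the quadratic that agrees with it at the end points of the range of \<open>u\<close>, the
    resulting quadratic in \<open>A\<close> by its chord.\<close>
  define u where "u = 40.001 - A"
  have u: "8.452 \<le> u" "u \<le> 20.002" "B \<le> u" using A19 A31 s by (auto simp: u_def s_def)
  have "B ^ 3 \<le> u ^ 3" using u B by (intro power_mono) auto
  also have "\<dots> \<le> 28.454 * u\<^sup>2 - 169.056904 * u"
  proof -
    have "0 \<le> u * ((u - 8.452) * (20.002 - u))" using u by (intro mult_nonneg_nonneg) auto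
    also have "\<dots> = 28.454 * u\<^sup>2 - 169.056904 * u - u ^ 3"
      by (simp add: power2_eq_square power3_eq_cube field_simps)
    finally show ?thesis by simp
  qed
  finally have B3: "B ^ 3 \<le> 28.454 * u\<^sup>2 - 169.056904 * u" .
  have chord: "A\<^sup>2 \<le> 51.548 * A - 630.948451"
  proof -
    have "0 \<le> (A - 19.999) * (31.549 - A)" using A19 A31 by (intro mult_nonneg_nonneg) auto
    also have "\<dots> = 51.548 * A - 630.948451 - A\<^sup>2"
      by (simp add: power2_eq_square field_simps)
    finally show ?thesis by simp
  qed
  have D: "diagonal_integral A = 8 * A\<^sup>2 - 255 * A + 6214 / 3"
    using A19 by (simp add: diagonal_integral_def ramp_def power2_eq_square power3_eq_cube algebra_simps)
  have L: "line_integral 20 = 7900 / 3"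
    by (simp add: line_integral_def ramp_def power2_eq_square power3_eq_cube)
  have "u\<^sup>2 = A\<^sup>2 - 80.002 * A + 1600.080001" by (simp add: u_def power2_eq_square field_simps)
  with B3 have "B ^ 3 \<le> 28.454 * (A\<^sup>2 - 80.002 * A + 1600.080001) - 169.056904 * (40.001 - A)"
    by (simp add: u_def)
  also have "\<dots> = 28.454 * A\<^sup>2 - 2107.320004 * A + 38766.231131550"
    by (simp add: field_simps)
  finally have "B ^ 3 \<le> 28.454 * A\<^sup>2 - 2107.320004 * A + 38766.231131550" .
  moreover have "10533.3 \<le> 16 * A\<^sup>2 - 315 * A + 12428 / 3 + 2 / 3 * B ^ 3 + 1 / 100"
    using cert unfolding D L by (simp add: algebra_simps)
  ultimately show False using chord A31 by simp
qed

section \<open>Small orthodox covers\<close>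

lemma card_outside_le:
  assumes "finite Q" "finite S" "S \<subseteq> f ` Q"
  shows "card {c \<in> Q. f c \<notin> S} + card S \<le> card Q"
proof -
  have "S = f ` {c \<in> Q. f c \<in> S}" using assms(3) by auto
  then have "card S \<le> card {c \<in> Q. f c \<in> S}"
    using assms(1) card_image_le[of "{c \<in> Q. f c \<in> S}" f] by simp
  moreover have "card Q = card {c \<in> Q. f c \<in> S} + card {c \<in> Q. f c \<notin> S}"
    using assms(1) by (subst card_Un_disjoint[symmetric]) (auto intro: arg_cong[of _ _ card])
  ultimately show ?thesis by simp
qed

lemma card_le_card_plus_missing:
  assumes "finite Q" "finite S"
  shows "card S \<le> card Q + card (S - f ` Q)"
proof -
  have "card S \<le> card (f ` Q \<union> (S - f ` Q))" using assms by (intro card_mono) auto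
  also have "\<dots> \<le> card (f ` Q) + card (S - f ` Q)" by (rule card_Un_le)
  finally show ?thesis using card_image_le[OF assms(1), of f] by simp
qed

lemma mod_eqE:
  fixes a b m :: int
  assumes "a mod m = b mod m"
  obtains k where "a = b + m * k"
proof -
  have "m dvd a - b" using assms by (simp add: mod_eq_dvd_iff)
  then obtain k where "a - b = m * k" by (rule dvdE)
  then show thesis using that[of k] by simp
qed

lemma double_mod_4_eq_iff:
  fixes x p m :: int
  shows "(2 * x - m) mod 4 = (2 * p - m) mod 4 \<longleftrightarrow> x mod 2 = p mod 2"
proof -
  have "4 dvd 2 * x - m - (2 * p - m) \<longleftrightarrow> 2 dvd x - p" by presburger
  then show ?thesis by (simp only: mod_eq_dvd_iff)
qed

text \<open>The bound on \<open>n\<close> is not optimised: the errors below are bounded by absolute constants, at most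
\<open>10 ^ 9\<close> after normalisation, and must not exceed \<open>n / 100\<close>.\<close>

locale small_orthodox_cover =
  fixes n :: nat and C :: "square set" and p q :: int
  assumes on_board: "C \<subseteq> board n"
    and dominates: "v \<in> board n \<Longrightarrow> v \<in> C \<or> (\<exists>c\<in>C. queen_adj v c)"
    and columns: "0 \<le> x \<Longrightarrow> x < int n \<Longrightarrow> x mod 2 = p mod 2 \<Longrightarrow> \<exists>y. (x, y) \<in> C"
    and rows: "0 \<le> y \<Longrightarrow> y < int n \<Longrightarrow> y mod 2 = q mod 2 \<Longrightarrow> \<exists>x. (x, y) \<in> C"
    and small: "2 * card C \<le> n + 3"
    and large: "10 ^ 11 \<le> n"
begin

abbreviation N :: int where "N \<equiv> int n - 1"

text \<open>Coordinates are centred. Those of columns and rows are doubled to stay integral, so that a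
  parity class of columns becomes a residue class modulo 4, like the classes of diagonals.\<close>

definition col :: "square \<Rightarrow> int" where "col c = 2 * fst c - N"
definition row :: "square \<Rightarrow> int" where "row c = 2 * snd c - N"
definition dif :: "square \<Rightarrow> int" where "dif c = snd c - fst c"
definition tot :: "square \<Rightarrow> int" where "tot c = fst c + snd c - N"

definition stray_columns :: "square set" where
  "stray_columns = {c \<in> C. fst c mod 2 \<noteq> p mod 2}"
definition stray_rows :: "square set" where
  "stray_rows = {c \<in> C. snd c mod 2 \<noteq> q mod 2}"
definition stray :: "square set" where
  "stray = stray_columns \<union> stray_rows"

text \<open>The class \<open>e\<close> is \<open>0\<close> or \<open>2\<close>. A queen in column \<open>p + 2 * i\<close> and row \<open>q + 2 * j\<close> has difference
\<open>q - p + 2 * (j - i)\<close> and centred sum \<open>p + q - N + 2 * (i + j)\<close>, and \<open>j - i\<close> and \<open>i + j\<close> have the same parity.\<close>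

definition dif_class :: "int \<Rightarrow> square set" where
  "dif_class e = {c \<in> C. dif c mod 4 = (q - p + e) mod 4}"
definition tot_class :: "int \<Rightarrow> square set" where
  "tot_class e = {c \<in> C. tot c mod 4 = (p + q - N + e) mod 4}"

lemma finite_C [simp]: "finite C"
  by (rule finite_subset[OF on_board]) (simp add: board_def)

lemma coordinates:
  assumes "c \<in> C"
  shows "0 \<le> fst c" "fst c \<le> N" "0 \<le> snd c" "snd c \<le> N"
  using assms on_board by (auto simp: board_def)

lemma coordinate_bounds:
  assumes "c \<in> C"
  shows "\<bar>col c\<bar> \<le> N" "\<bar>row c\<bar> \<le> N" "\<bar>dif c\<bar> \<le> N" "\<bar>tot c\<bar> \<le> N"
  using coordinates[OF assms] by (auto simp: col_def row_def dif_def tot_def)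

lemma N_nonneg: "0 \<le> N"
  using large by simp

lemma columns_filled: "progression (2 * p - N) N \<subseteq> col ` C"
proof
  fix k assume k: "k \<in> progression (2 * p - N) N"
  then obtain u where u: "k = 2 * p - N + 4 * u"
    unfolding progression_def by (auto elim: mod_eqE)
  define x where "x = p + 2 * u"
  have x: "2 * x = k + N" by (simp add: x_def u)
  have "x mod 2 = p mod 2" by (simp add: x_def)
  moreover have "0 \<le> x" "x < int n" using x k by (auto simp: progression_def)
  ultimately obtain y where "(x, y) \<in> C" using columns by blast
  moreover have "k = col (x, y)" using x by (simp add: col_def)
  ultimately show "k \<in> col ` C" by blast
qed

lemma rows_filled: "progression (2 * q - N) N \<subseteq> row ` C"
proof
  fix k assume k: "k \<in> progression (2 * q - N) N"
  then obtain u where u: "k = 2 * q - N + 4 * u"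
    unfolding progression_def by (auto elim: mod_eqE)
  define y where "y = q + 2 * u"
  have y: "2 * y = k + N" by (simp add: y_def u)
  have "y mod 2 = q mod 2" by (simp add: y_def)
  moreover have "0 \<le> y" "y < int n" using y k by (auto simp: progression_def)
  ultimately obtain x where "(x, y) \<in> C" using rows by blast
  moreover have "k = row (x, y)" using y by (simp add: row_def)
  ultimately show "k \<in> row ` C" by blast
qed

text \<open>The progression, read as the columns of one parity, has about \<open>n / 2\<close> points, so the queens are almost
as few as the columns that they have to meet.\<close>

lemma card_C_le: "card C \<le> card (progression r N) + 4"
proof -
  have "2 * real (card C) \<le> real n + 3" using small by linarith
  moreover have "of_int N / 2 - 2 \<le> real (card (progression r N))"
    using card_progression[OF N_nonneg, of r] unfolding abs_le_iff by linarith
  then have "real n / 2 - 5 / 2 \<le> real (card (progression r N))"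
    by (simp add: diff_divide_distrib)
  ultimately have "real (card C) \<le> real (card (progression r N)) + 4" by linarith
  then show ?thesis by linarith
qed

lemma card_stray_columns: "card stray_columns \<le> 4"
proof -
  have "stray_columns \<subseteq> {c \<in> C. col c \<notin> progression (2 * p - N) N}"
  proof
    fix c assume c: "c \<in> stray_columns"
    then have "col c mod 4 \<noteq> (2 * p - N) mod 4"
      unfolding stray_columns_def col_def double_mod_4_eq_iff by simp
    then show "c \<in> {c \<in> C. col c \<notin> progression (2 * p - N) N}"
      using c by (simp add: stray_columns_def progression_def)
  qed
  then have "card stray_columns \<le> card {c \<in> C. col c \<notin> progression (2 * p - N) N}"
    by (intro card_mono) auto
  then show ?thesis
    using card_outside_le[OF finite_C finite_progression columns_filled] card_C_le[of "2 * p - N"] by linarith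
qed

lemma card_stray_rows: "card stray_rows \<le> 4"
proof -
  have "stray_rows \<subseteq> {c \<in> C. row c \<notin> progression (2 * q - N) N}"
  proof
    fix c assume c: "c \<in> stray_rows"
    then have "row c mod 4 \<noteq> (2 * q - N) mod 4"
      unfolding stray_rows_def row_def double_mod_4_eq_iff by simp
    then show "c \<in> {c \<in> C. row c \<notin> progression (2 * q - N) N}"
      using c by (simp add: stray_rows_def progression_def)
  qed
  then have "card stray_rows \<le> card {c \<in> C. row c \<notin> progression (2 * q - N) N}"
    by (intro card_mono) auto
  then show ?thesis
    using card_outside_le[OF finite_C finite_progression rows_filled] card_C_le[of "2 * q - N"] by linarith
qed

lemma finite_stray [simp]: "finite stray" "finite stray_columns" "finite stray_rows"
  by (auto simp: stray_def stray_columns_def stray_rows_def)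

lemma card_stray: "card stray \<le> 8"
  using card_Un_le[of stray_columns stray_rows] card_stray_columns card_stray_rows
  unfolding stray_def by linarith

lemma finite_classes [simp]: "finite (dif_class e)" "finite (tot_class e)"
  by (auto simp: dif_class_def tot_class_def)

lemma regular_coordinates:
  assumes "c \<in> C" "c \<notin> stray"
  obtains i j where "fst c = p + 2 * i" "snd c = q + 2 * j"
proof -
  have "fst c mod 2 = p mod 2" "snd c mod 2 = q mod 2"
    using assms by (auto simp: stray_def stray_columns_def stray_rows_def)
  then show thesis using that by (metis mod_eqE)
qed

lemma classes_agree:
  assumes "c \<in> C" "c \<notin> stray" "e \<in> {0, 2}"
  shows "c \<in> dif_class e \<longleftrightarrow> c \<in> tot_class e"
proof -
  obtain i j where ij: "fst c = p + 2 * i" "snd c = q + 2 * j"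
    by (rule regular_coordinates[OF assms(1,2)])
  have "4 dvd dif c - (q - p + e) \<longleftrightarrow> 4 dvd tot c - (p + q - N + e)"
    using assms(3) by (auto simp: dif_def tot_def ij; presburger)
  then show ?thesis using assms(1) by (simp add: dif_class_def tot_class_def mod_eq_dvd_iff)
qed

lemma classes_cover:
  assumes "c \<in> C" "c \<notin> stray"
  shows "c \<in> dif_class 0 \<or> c \<in> dif_class 2"
proof -
  obtain i j where ij: "fst c = p + 2 * i" "snd c = q + 2 * j"
    by (rule regular_coordinates[OF assms])
  have "4 dvd 2 * (j - i) \<or> 4 dvd 2 * (j - i) - 2" by presburger
  then have "4 dvd dif c - (q - p + 0) \<or> 4 dvd dif c - (q - p + 2)"
    by (simp add: dif_def ij algebra_simps)
  then show ?thesis using assms(1) by (auto simp: dif_class_def mod_eq_dvd_iff)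
qed

lemma classes_disjoint: "dif_class 0 \<inter> dif_class 2 = {}" "tot_class 0 \<inter> tot_class 2 = {}"
proof -
  have False if "(k :: int) mod 4 = (m + 0) mod 4" "k mod 4 = (m + 2) mod 4" for k m
  proof -
    have "(m + 2) mod 4 = m mod 4" using that by simp
    then show False by (simp add: mod_eq_dvd_iff)
  qed
  then show "dif_class 0 \<inter> dif_class 2 = {}" "tot_class 0 \<inter> tot_class 2 = {}"
    unfolding dif_class_def tot_class_def by blast+
qed

lemma card_classes: "card (dif_class 0) + card (dif_class 2) \<le> card C"
proof -
  have "card (dif_class 0 \<union> dif_class 2) \<le> card C"
    by (intro card_mono) (auto simp: dif_class_def)
  then show ?thesis using classes_disjoint by (simp add: card_Un_disjoint)
qed

lemma card_classes_close:
  assumes "e \<in> {0, 2}"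
  shows "card (dif_class e) \<le> card (tot_class e) + 8" "card (tot_class e) \<le> card (dif_class e) + 8"
proof -
  have "dif_class e \<subseteq> tot_class e \<union> stray" "tot_class e \<subseteq> dif_class e \<union> stray"
    using classes_agree[OF _ _ assms] by (auto simp: dif_class_def tot_class_def)
  then have "card (dif_class e) \<le> card (tot_class e \<union> stray)" "card (tot_class e) \<le> card (dif_class e \<union> stray)"
    by (auto intro!: card_mono)
  then show "card (dif_class e) \<le> card (tot_class e) + 8" "card (tot_class e) \<le> card (dif_class e) + 8"
    using card_Un_le[of "tot_class e" stray] card_Un_le[of "dif_class e" stray] card_stray by linarith+
qed

text \<open>Let the difference \<open>d\<close> of class \<open>e\<close> be unoccupied. A sum \<open>t\<close> of the opposite class with
\<open>\<bar>d\<bar> + \<bar>t\<bar> \<le> N\<close> meets it in a square of the board whose column and row both have the wrong parity. If \<open>t\<close>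
is unoccupied too, a stray queen shares the column or the row of this square; either of
them, together with \<open>d\<close>, determines \<open>t\<close>.\<close>

lemma missing_difference:
  assumes e: "e \<in> {0, 2}" and d: "d mod 4 = (q - p + e) mod 4" "d \<notin> dif ` C"
  shows "card (progression (p + q - N + (2 - e)) (N - \<bar>d\<bar>) - tot ` tot_class (2 - e)) \<le> 8"
proof -
  let ?X = "(\<lambda>c. 2 * fst c + d - N) ` stray_columns" and ?Y = "(\<lambda>c. 2 * snd c - d - N) ` stray_rows"
  have "progression (p + q - N + (2 - e)) (N - \<bar>d\<bar>) - tot ` tot_class (2 - e) \<subseteq> ?X \<union> ?Y"
  proof
    fix t assume t: "t \<in> progression (p + q - N + (2 - e)) (N - \<bar>d\<bar>) - tot ` tot_class (2 - e)"
    have tm: "t mod 4 = (p + q - N + (2 - e)) mod 4" "\<bar>t\<bar> \<le> N - \<bar>d\<bar>"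
      using t by (auto simp: progression_def)
    obtain u where u: "t = p + q - N + (2 - e) + 4 * u" by (rule mod_eqE[OF tm(1)])
    obtain v where v: "d = q - p + e + 4 * v" by (rule mod_eqE[OF d(1)])
    define x where "x = p + 1 - e + 2 * u - 2 * v"
    define y where "y = x + d"
    have x: "2 * x = t + N - d" by (simp add: x_def u v)
    have "odd (x - p)" "odd (y - q)" using e by (auto simp: y_def x_def v)
    then have xm: "x mod 2 \<noteq> p mod 2" and ym: "y mod 2 \<noteq> q mod 2"
      by (simp_all add: mod_eq_dvd_iff)
    have "0 \<le> x" "x \<le> N" "0 \<le> y" "y \<le> N" using x tm(2) unfolding y_def by linarith+
    then have board: "(x, y) \<in> board n" by (simp add: board_def)
    have no_dif: "dif c \<noteq> d" if "c \<in> C" for c using that d(2) by auto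
    have no_tot: "tot c \<noteq> t" if "c \<in> C" for c
    proof
      assume "tot c = t"
      then have "c \<in> tot_class (2 - e)" using that tm(1) by (simp add: tot_class_def)
      then show False using t \<open>tot c = t\<close> by blast
    qed
    have "\<exists>c\<in>C. fst c = x \<or> snd c = y"
    proof (cases "(x, y) \<in> C")
      case False
      then obtain c where c: "c \<in> C" "queen_adj (x, y) c" using dominates[OF board] by blast
      have "dif c \<noteq> y - x" "tot c \<noteq> x + y - N"
        using no_dif[OF c(1)] no_tot[OF c(1)] x by (auto simp: y_def)
      then have "fst c = x \<or> snd c = y"
        using c(2) by (auto simp: queen_adj_def dif_def tot_def split: prod.splits)
      then show ?thesis using c(1) by blast
    qed force
    then obtain c where c: "c \<in> C" "fst c = x \<or> snd c = y" by blast
    from c(2) show "t \<in> ?X \<union> ?Y"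
    proof
      assume "fst c = x"
      moreover from this have "c \<in> stray_columns" using c xm by (simp add: stray_columns_def)
      ultimately have "t \<in> ?X" using x by (intro image_eqI[of _ _ c]) auto
      then show ?thesis by blast
    next
      assume "snd c = y"
      moreover from this have "c \<in> stray_rows" using c ym by (simp add: stray_rows_def)
      ultimately have "t \<in> ?Y" using x by (intro image_eqI[of _ _ c]) (auto simp: y_def)
      then show ?thesis by blast
    qed
  qed
  then have "card (progression (p + q - N + (2 - e)) (N - \<bar>d\<bar>) - tot ` tot_class (2 - e)) \<le> card (?X \<union> ?Y)"
    by (intro card_mono) auto
  also have "\<dots> \<le> card ?X + card ?Y" by (rule card_Un_le)
  also have "\<dots> \<le> card stray_columns + card stray_rows" by (intro add_mono card_image_le) auto
  finally show ?thesis using card_stray_columns card_stray_rows by linarith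
qed

text \<open>The radius is the distance of the first missing difference of class \<open>e\<close> from the centre, cut off
at \<open>N\<close>. The differences of class \<open>e\<close> of radius \<open>a\<close> are then all present, except possibly \<open>a\<close> and \<open>- a\<close>.\<close>

lemma radius:
  assumes e: "e \<in> {0, 2}"
  obtains a where "0 \<le> a" "a \<le> N" "card (progression (q - p + e) a - dif ` dif_class e) \<le> 2"
    "card (progression (p + q - N + (2 - e)) (N - a) - tot ` tot_class (2 - e)) \<le> 8"
proof -
  define P where "P m \<longleftrightarrow> N \<le> int m \<or>
    (\<exists>d. \<bar>d\<bar> = int m \<and> d mod 4 = (q - p + e) mod 4 \<and> d \<notin> dif ` C)" for m :: nat
  define m where "m = (LEAST m. P m)"
  have PN: "P (nat N)" using N_nonneg by (simp add: P_def)
  have Pm: "P m" unfolding m_def using PN by (rule LeastI)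
  have mN: "int m \<le> N" using Least_le[of P, OF PN] N_nonneg by (simp add: m_def)
  have "progression (q - p + e) (int m) - dif ` dif_class e \<subseteq> {int m, - int m}"
  proof
    fix d assume d: "d \<in> progression (q - p + e) (int m) - dif ` dif_class e"
    then have dm: "d mod 4 = (q - p + e) mod 4" "\<bar>d\<bar> \<le> int m" by (auto simp: progression_def)
    have "d \<notin> dif ` C" using d dm(1) by (auto simp: dif_class_def)
    then have "P (nat \<bar>d\<bar>)" using dm by (auto simp: P_def)
    then have "m \<le> nat \<bar>d\<bar>" unfolding m_def by (rule Least_le)
    then show "d \<in> {int m, - int m}" using dm(2) by auto
  qed
  then have "card (progression (q - p + e) (int m) - dif ` dif_class e) \<le> card {int m, - int m}"
    by (intro card_mono) auto
  also have "\<dots> \<le> 2" by (simp add: card_insert_if)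
  finally have 1: "card (progression (q - p + e) (int m) - dif ` dif_class e) \<le> 2" .
  have 2: "card (progression (p + q - N + (2 - e)) (N - int m) - tot ` tot_class (2 - e)) \<le> 8"
  proof (cases "\<exists>d. \<bar>d\<bar> = int m \<and> d mod 4 = (q - p + e) mod 4 \<and> d \<notin> dif ` C")
    case True
    then show ?thesis using missing_difference[OF e] by metis
  next
    case False
    then have "N - int m = 0" using Pm mN by (auto simp: P_def)
    then have "progression (p + q - N + (2 - e)) (N - int m) - tot ` tot_class (2 - e) \<subseteq> {0}"
      by (auto simp: progression_def)
    then have "card (progression (p + q - N + (2 - e)) (N - int m) - tot ` tot_class (2 - e)) \<le> card {0::int}"
      by (intro card_mono) auto
    then show ?thesis by simp
  qed
  show thesis using that[of "int m"] mN 1 2 by simp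
qed

text \<open>Let \<open>a 0\<close> and \<open>a 2\<close> be the radii of the two classes. Class \<open>e\<close> has at least about \<open>a e / 2\<close> queens
because of its differences, and the opposite class at least about \<open>(N - a e) / 2\<close> because of its sums.
These two numbers already add up to the available \<open>n / 2\<close>, so both bounds are attained up to
a constant: nearly no queen is left for a repeated diagonal or for one outside the intervals.\<close>

lemma class_structure:
  obtains a :: "int \<Rightarrow> int" where
    "\<And>e. e \<in> {0, 2} \<Longrightarrow> 0 \<le> a e \<and> a e \<le> N"
    "\<bar>a 0 + a 2 - N\<bar> \<le> 80"
    "\<And>e. e \<in> {0, 2} \<Longrightarrow> fills (dif_class e) dif (q - p + e) (a e) 80"
    "\<And>e. e \<in> {0, 2} \<Longrightarrow> fills (tot_class e) tot (p + q - N + e) (N - a (2 - e)) 80"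
    "\<And>e. e \<in> {0, 2} \<Longrightarrow> real (card (dif_class e)) \<le> of_int (a e) / 2 + 30"
proof -
  have "\<exists>a. \<forall>e\<in>{0, 2}. 0 \<le> a e \<and> a e \<le> N
      \<and> card (progression (q - p + e) (a e) - dif ` dif_class e) \<le> 2
      \<and> card (progression (p + q - N + (2 - e)) (N - a e) - tot ` tot_class (2 - e)) \<le> 8"
    by (rule bchoice) (metis radius)
  then obtain a where all: "\<forall>e\<in>{0, 2}. 0 \<le> a e \<and> a e \<le> N
      \<and> card (progression (q - p + e) (a e) - dif ` dif_class e) \<le> 2
      \<and> card (progression (p + q - N + (2 - e)) (N - a e) - tot ` tot_class (2 - e)) \<le> 8"
    by (rule exE)
  have a: "0 \<le> a e" "a e \<le> N"
      "card (progression (q - p + e) (a e) - dif ` dif_class e) \<le> 2"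
      "card (progression (p + q - N + (2 - e)) (N - a e) - tot ` tot_class (2 - e)) \<le> 8"
    if "e \<in> {0, 2}" for e using bspec[OF all that] by blast+
  have counts: "of_int (a e) / 2 - 4 \<le> real (card (dif_class e))"
      "(of_int N - of_int (a e)) / 2 - 18 \<le> real (card (dif_class (2 - e)))"
    if e: "e \<in> {0, 2}" for e
  proof -
    have "card (progression (q - p + e) (a e)) \<le> card (dif_class e) + 2"
      using card_le_card_plus_missing[of "dif_class e" "progression (q - p + e) (a e)" dif] a(3)[OF e] by simp
    then show "of_int (a e) / 2 - 4 \<le> real (card (dif_class e))"
      using card_progression[of "a e" "q - p + e"] a(1)[OF e] by linarith
    have "card (progression (p + q - N + (2 - e)) (N - a e)) \<le> card (tot_class (2 - e)) + 8"
      using card_le_card_plus_missing[of "tot_class (2 - e)" "progression (p + q - N + (2 - e)) (N - a e)" tot]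
        a(4)[OF e] by simp
    then have "card (progression (p + q - N + (2 - e)) (N - a e)) \<le> card (dif_class (2 - e)) + 16"
      using card_classes_close(2)[of "2 - e"] e by auto
    then show "(of_int N - of_int (a e)) / 2 - 18 \<le> real (card (dif_class (2 - e)))"
      using card_progression[of "N - a e" "p + q - N + (2 - e)"] a(2)[OF e]
      unfolding of_int_diff[symmetric] by linarith
  qed
  have total: "real (card (dif_class e)) + real (card (dif_class (2 - e))) \<le> of_int N / 2 + 2"
    if e: "e \<in> {0, 2}" for e
  proof -
    have "2 * (card (dif_class e) + card (dif_class (2 - e))) \<le> n + 3"
      using card_classes small e by auto
    then have "real (2 * (card (dif_class e) + card (dif_class (2 - e)))) \<le> real (n + 3)"
      by (rule of_nat_mono)
    then have "real (card (dif_class e)) + real (card (dif_class (2 - e))) \<le> (real n + 3) / 2"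
      by simp
    also have "\<dots> = of_int N / 2 + 2" by (simp add: field_simps)
    finally show ?thesis .
  qed
  have upper: "real (card (dif_class e)) \<le> of_int (a e) / 2 + 20" if e: "e \<in> {0, 2}" for e
    using total[OF e] counts(2)[OF e] by (simp add: diff_divide_distrib)
  show thesis
  proof
    show "0 \<le> a e \<and> a e \<le> N" if "e \<in> {0, 2}" for e using a that by blast
    have even: "(0::int) \<in> {0, 2}" "(2::int) \<in> {0, 2}" "2 - 0 = (2::int)" by auto
    have "(of_int N - of_int (a 0)) / 2 - 18 \<le> (of_int (a 2) / 2 + 20 :: real)"
      using order_trans[OF counts(2)[OF even(1), unfolded even(3)] upper[OF even(2)]] .
    moreover have "of_int (a 0) / 2 - 4 + (of_int (a 2) / 2 - 4) \<le> (of_int N / 2 + 2 :: real)"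
      using order_trans[OF add_mono[OF counts(1)[OF even(1)] counts(1)[OF even(2)]]
        total[OF even(1), unfolded even(3)]] .
    ultimately have "real_of_int (a 0 + a 2 - N) \<le> 80" "- 80 \<le> real_of_int (a 0 + a 2 - N)"
      by (simp_all add: field_simps)
    then show "\<bar>a 0 + a 2 - N\<bar> \<le> 80" by linarith
    fix e :: int assume e: "e \<in> {0, 2}"
    then have e': "2 - e \<in> {0, 2}" by auto
    show "real (card (dif_class e)) \<le> of_int (a e) / 2 + 30" using upper[OF e] by simp
    have "card (dif_class e) \<le> card (progression (q - p + e) (a e)) + 80"
      using upper[OF e] card_progression[of "a e" "q - p + e"] a(1)[OF e] by linarith
    then show "fills (dif_class e) dif (q - p + e) (a e) 80"
      using a(3)[OF e] by (simp add: fills_def)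
    have "real (card (tot_class e)) \<le> real (card (dif_class e)) + 8"
      using card_classes_close(2)[OF e] by linarith
    moreover have "real (card (dif_class e)) \<le> (of_int N - of_int (a (2 - e))) / 2 + 10"
      using total[OF e] counts(1)[OF e'] by (simp add: diff_divide_distrib)
    ultimately have "card (tot_class e) \<le> card (progression (p + q - N + e) (N - a (2 - e))) + 80"
      using card_progression[of "N - a (2 - e)" "p + q - N + e"] a(2)[OF e']
      unfolding of_int_diff[symmetric] by linarith
    then show "fills (tot_class e) tot (p + q - N + e) (N - a (2 - e)) 80"
      using a(4)[OF e'] by (simp add: fills_def)
  qed
qed

definition scale :: real where "scale = 20 / real n"

text \<open>In these coordinates the board is the square of half-width \<open>20\<close>; the point \<open>20\<close> corresponds to \<open>n\<close>
  rather than to \<open>N\<close>.\<close>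

definition X :: "square \<Rightarrow> real" where "X c = scale * of_int (col c)"
definition Y :: "square \<Rightarrow> real" where "Y c = scale * of_int (row c)"
definition D :: "square \<Rightarrow> real" where "D c = 2 * scale * of_int (dif c)"
definition T :: "square \<Rightarrow> real" where "T c = 2 * scale * of_int (tot c)"

lemma D_T_eq: "D c = Y c - X c" "T c = X c + Y c"
  by (simp_all add: X_def Y_def D_def T_def col_def row_def dif_def tot_def algebra_simps)

lemma real_n: "10 ^ 11 \<le> real n"
  using large by (metis of_nat_le_iff of_nat_numeral of_nat_power)

lemma scale: "0 < scale" "scale * real n = 20"
  using real_n by (auto simp: scale_def)

lemma scale_times_bound:
  assumes "\<bar>u\<bar> \<le> real n + 10"
  shows "\<bar>scale * u\<bar> \<le> 25"
proof -
  have "\<bar>scale * u\<bar> \<le> scale * (real n + 10)" using assms scale by (auto simp: abs_mult intro: mult_left_mono)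
  also have "\<dots> = 20 + 200 / real n" using real_n by (simp add: scale_def field_simps)
  also have "\<dots> \<le> 25" using real_n by (simp add: field_simps)
  finally show ?thesis .
qed

lemma scaled_bounds:
  assumes "c \<in> C"
  shows "\<bar>X c\<bar> \<le> 50" "\<bar>Y c\<bar> \<le> 50" "\<bar>D c\<bar> \<le> 50" "\<bar>T c\<bar> \<le> 50"
proof -
  have *: "\<bar>scale * of_int k\<bar> \<le> 25" if "\<bar>k\<bar> \<le> N" for k
    using that by (intro scale_times_bound) linarith
  note b = coordinate_bounds[OF assms, THEN *]
  show "\<bar>X c\<bar> \<le> 50" "\<bar>Y c\<bar> \<le> 50" "\<bar>D c\<bar> \<le> 50" "\<bar>T c\<bar> \<le> 50"
    using b(1) b(2) b(3) b(4) by (simp_all add: X_def Y_def D_def T_def mult.assoc)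
qed

lemma line_sums:
  assumes g: "profile g H" "g 50 \<le> 2500"
  shows "\<bar>(\<Sum>c\<in>C. g (X c)) - real n * H 20 / 40\<bar> \<le> 750000"
    and "\<bar>(\<Sum>c\<in>C. g (Y c)) - real n * H 20 / 40\<bar> \<le> 750000"
proof -
  have b: "scale * (of_int N + 4) \<le> 50" "scale * real n \<le> 50"
    using scale_times_bound[of "of_int N + 4"] scale real_n by (auto simp: abs_le_iff)
  have H: "H (scale * real n) / (2 * scale) = real n * H 20 / 40"
    using scale real_n by (simp add: scale_def)
  have "fills C col (2 * p - N) N 80" "fills C row (2 * q - N) N 80"
    using columns_filled rows_filled card_C_le[of "2 * p - N"] card_C_le[of "2 * q - N"]
    by (auto simp: fills_def Diff_eq_empty_iff[THEN iffD2])
  then show "\<bar>(\<Sum>c\<in>C. g (X c)) - real n * H 20 / 40\<bar> \<le> 750000"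
    "\<bar>(\<Sum>c\<in>C. g (Y c)) - real n * H 20 / 40\<bar> \<le> 750000"
    using fills_riemann_sum[OF _ g(1) scale(1) N_nonneg _ _ b _ g(2), of C col "2 * p - N"]
      fills_riemann_sum[OF _ g(1) scale(1) N_nonneg _ _ b _ g(2), of C row "2 * q - N"]
      scaled_bounds H by (simp_all add: X_def Y_def)
qed

lemma diagonal_sum:
  assumes g: "profile g H" "g 50 \<le> 2500" and Q: "fills Q f r R 80" "Q \<subseteq> C"
    and f: "\<And>c. c \<in> C \<Longrightarrow> \<bar>f c\<bar> \<le> N"
    and R: "0 \<le> R" "R \<le> N" "0 \<le> a" "a \<le> N" "\<bar>R - a\<bar> \<le> 80"
  shows "\<bar>(\<Sum>c\<in>Q. g (2 * scale * of_int (f c))) - real n * H (2 * scale * of_int a) / 80\<bar> \<le> 750000"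
proof -
  have le: "\<bar>2 * scale * u\<bar> \<le> 50" if "\<bar>u\<bar> \<le> real n + 10" for u
    using scale_times_bound[OF that] by simp
  have "2 * scale * (of_int R + 4) \<le> 50" "2 * scale * of_int a \<le> 50"
    using le[of "of_int R + 4"] le[of "of_int a"] R by (auto simp: abs_le_iff)
  moreover have "\<bar>2 * scale * of_int (f c)\<bar> \<le> 50" if "c \<in> Q" for c
  proof (rule le)
    have "\<bar>f c\<bar> \<le> N" using f that Q(2) by blast
    then show "\<bar>of_int (f c)\<bar> \<le> real n + 10" by linarith
  qed
  moreover have "\<bar>of_int R - of_int a\<bar> \<le> (80 :: real)" using R(5) by linarith
  ultimately have "\<bar>(\<Sum>c\<in>Q. g (2 * scale * of_int (f c)))
      - H (2 * scale * of_int a) / (2 * (2 * scale))\<bar> \<le> 300 * 2500"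
    using scale R by (intro fills_riemann_sum[OF Q(1) g(1) _ R(1) _ _ _ _ _ g(2)]) auto
  moreover have "H (2 * scale * of_int a) / (2 * (2 * scale)) = real n * H (2 * scale * of_int a) / 80"
    using real_n by (simp add: scale_def)
  ultimately show ?thesis by simp
qed

lemma sum_classes_le:
  assumes "e \<in> {0, 2}" "\<And>c. 0 \<le> g c"
  shows "(\<Sum>c\<in>dif_class e. g c) + (\<Sum>c\<in>dif_class (2 - e). g c) \<le> (\<Sum>c\<in>C. g c)"
    and "(\<Sum>c\<in>tot_class e. g c) + (\<Sum>c\<in>tot_class (2 - e). g c) \<le> (\<Sum>c\<in>C. g c :: real)"
proof -
  have "dif_class e \<inter> dif_class (2 - e) = {}" "tot_class e \<inter> tot_class (2 - e) = {}"
    using classes_disjoint assms(1) by auto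
  then have "(\<Sum>c\<in>dif_class e. g c) + (\<Sum>c\<in>dif_class (2 - e). g c) = (\<Sum>c\<in>dif_class e \<union> dif_class (2 - e). g c)"
    "(\<Sum>c\<in>tot_class e. g c) + (\<Sum>c\<in>tot_class (2 - e). g c) = (\<Sum>c\<in>tot_class e \<union> tot_class (2 - e). g c)"
    by (simp_all add: sum.union_disjoint)
  moreover have "(\<Sum>c\<in>dif_class e \<union> dif_class (2 - e). g c) \<le> (\<Sum>c\<in>C. g c)"
    "(\<Sum>c\<in>tot_class e \<union> tot_class (2 - e). g c) \<le> (\<Sum>c\<in>C. g c)"
    using assms(2) by (auto intro!: sum_mono2 simp: dif_class_def tot_class_def)
  ultimately show "(\<Sum>c\<in>dif_class e. g c) + (\<Sum>c\<in>dif_class (2 - e). g c) \<le> (\<Sum>c\<in>C. g c)"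
    "(\<Sum>c\<in>tot_class e. g c) + (\<Sum>c\<in>tot_class (2 - e). g c) \<le> (\<Sum>c\<in>C. g c)" by simp_all
qed

text \<open>Each queen that is not a stray is counted by its class: with the diagonal weights in class \<open>e\<close>, and with
\<open>2 * X\<^sup>2 + 2 * Y\<^sup>2 = D\<^sup>2 + T\<^sup>2\<close> in the other class. Strays may belong to different classes by
difference and by sum; they are charged separately, at most \<open>5000\<close> each.\<close>

lemma certificate_sum:
  assumes e: "e \<in> {0, 2}"
  shows "(\<Sum>c\<in>C. line_weight (X c)) + (\<Sum>c\<in>C. line_weight (Y c))
    \<le> (\<Sum>c\<in>dif_class e. diagonal_weight (D c)) + (\<Sum>c\<in>tot_class e. diagonal_weight (T c))
      + 195 * real (card (dif_class e))
      + (\<Sum>c\<in>dif_class (2 - e). (D c)\<^sup>2) + (\<Sum>c\<in>tot_class (2 - e). (T c)\<^sup>2) + 40000"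
proof -
  let ?on = "\<lambda>S g c. if c \<in> S then g c else (0::real)"
  have e': "2 - e \<in> {0, 2}" using e by auto
  have restrict: "(\<Sum>c\<in>C. ?on S g c) = (\<Sum>c\<in>S. g c)" if "S \<subseteq> C" for S g
    using that by (simp add: sum.inter_restrict[symmetric] Int_absorb1)
  have pointwise: "line_weight (X c) + line_weight (Y c)
      \<le> ?on (dif_class e) (\<lambda>c. diagonal_weight (D c)) c + ?on (tot_class e) (\<lambda>c. diagonal_weight (T c)) c
        + ?on (dif_class e) (\<lambda>_. 195) c
        + ?on (dif_class (2 - e)) (\<lambda>c. (D c)\<^sup>2) c + ?on (tot_class (2 - e)) (\<lambda>c. (T c)\<^sup>2) c
        + ?on stray (\<lambda>_. 5000) c" if c: "c \<in> C" for c
  proof -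
    have nonneg: "0 \<le> diagonal_weight u" for u by (rule profile_nonneg[OF profile_diagonal_weight])
    show ?thesis
    proof (cases "c \<in> stray")
      case True
      have "line_weight u \<le> 2500" if "\<bar>u\<bar> \<le> 50" for u
        using profile_mono[OF profile_line_weight, of "\<bar>u\<bar>" 50] profile_abs[OF profile_line_weight, of u] that
        by (simp add: line_weight_simps(2)[of 50])
      then have "line_weight (X c) + line_weight (Y c) \<le> 5000"
        using scaled_bounds[OF c] by (smt (verit))
      moreover have "?on stray (\<lambda>_. 5000) c = 5000" using True by simp
      moreover have "0 \<le> ?on (dif_class e) (\<lambda>c. diagonal_weight (D c)) c"
        "0 \<le> ?on (tot_class e) (\<lambda>c. diagonal_weight (T c)) c" "0 \<le> ?on (dif_class e) (\<lambda>_. 195) c"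
        "0 \<le> ?on (dif_class (2 - e)) (\<lambda>c. (D c)\<^sup>2) c" "0 \<le> ?on (tot_class (2 - e)) (\<lambda>c. (T c)\<^sup>2) c"
        using nonneg by simp_all
      ultimately show ?thesis by linarith
    next
      case False
      note agree = classes_agree[OF c False e] classes_agree[OF c False e']
      show ?thesis
      proof (cases "c \<in> dif_class e")
        case True
        then have "line_weight (X c) + line_weight (Y c) \<le> diagonal_weight (D c) + diagonal_weight (T c) + 195"
          using line_weight_le_diagonal_weight[of "X c" "Y c"] by (simp add: D_T_eq)
        then show ?thesis using True agree(1) False by (auto intro!: add_increasing2)
      next
        case not_e: False
        then have c2: "c \<in> dif_class (2 - e)" using classes_cover[OF c False] e by auto
        have "line_weight (X c) + line_weight (Y c) \<le> (D c)\<^sup>2 + (T c)\<^sup>2"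
          using line_weight_le_square[of "X c"] line_weight_le_square[of "Y c"]
          by (simp add: D_T_eq power2_eq_square algebra_simps)
        then show ?thesis using c2 not_e agree False by simp
      qed
    qed
  qed
  have sub: "dif_class e \<subseteq> C" "dif_class (2 - e) \<subseteq> C" "tot_class e \<subseteq> C" "tot_class (2 - e) \<subseteq> C" "stray \<subseteq> C"
    by (auto simp: dif_class_def tot_class_def stray_def stray_columns_def stray_rows_def)
  have "(\<Sum>c\<in>C. line_weight (X c)) + (\<Sum>c\<in>C. line_weight (Y c))
      = (\<Sum>c\<in>C. line_weight (X c) + line_weight (Y c))" by (simp add: sum.distrib)
  also have "\<dots> \<le> (\<Sum>c\<in>C. ?on (dif_class e) (\<lambda>c. diagonal_weight (D c)) c
        + ?on (tot_class e) (\<lambda>c. diagonal_weight (T c)) c + ?on (dif_class e) (\<lambda>_. 195) c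
        + ?on (dif_class (2 - e)) (\<lambda>c. (D c)\<^sup>2) c + ?on (tot_class (2 - e)) (\<lambda>c. (T c)\<^sup>2) c
        + ?on stray (\<lambda>_. 5000) c)"
    by (rule sum_mono) (rule pointwise)
  also have "\<dots> = (\<Sum>c\<in>dif_class e. diagonal_weight (D c)) + (\<Sum>c\<in>tot_class e. diagonal_weight (T c))
      + 195 * real (card (dif_class e))
      + (\<Sum>c\<in>dif_class (2 - e). (D c)\<^sup>2) + (\<Sum>c\<in>tot_class (2 - e). (T c)\<^sup>2) + 5000 * real (card stray)"
    unfolding sum.distrib restrict[OF sub(1)] restrict[OF sub(2)] restrict[OF sub(3)]
      restrict[OF sub(4)] restrict[OF sub(5)] by simp
  finally show ?thesis using card_stray by simp
qed

text \<open>The second moments give \<open>cubes\<close>, where only the lower estimate for the diagonals and the upper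
estimate for the lines are needed, and \<open>certificate_sum\<close> gives \<open>cert\<close>, both after division by \<open>n / 80\<close>.\<close>

lemma impossible: False
proof -
  obtain a where a: "\<And>e. e \<in> {0, 2} \<Longrightarrow> 0 \<le> a e \<and> a e \<le> N"
    "\<bar>a 0 + a 2 - N\<bar> \<le> 80"
    "\<And>e. e \<in> {0, 2} \<Longrightarrow> fills (dif_class e) dif (q - p + e) (a e) 80"
    "\<And>e. e \<in> {0, 2} \<Longrightarrow> fills (tot_class e) tot (p + q - N + e) (N - a (2 - e)) 80"
    "\<And>e. e \<in> {0, 2} \<Longrightarrow> real (card (dif_class e)) \<le> of_int (a e) / 2 + 30"
    by (rule class_structure) blast
  define e where "e = (if a 2 \<le> a 0 then 0 else 2 :: int)"
  have e: "e \<in> {0, 2}" "2 - e \<in> {0, 2}" "a (2 - e) \<le> a e" "\<bar>a e + a (2 - e) - N\<bar> \<le> 80"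
    using a(2) by (auto simp: e_def)
  define A B where "A = 2 * scale * of_int (a e)" and "B = 2 * scale * of_int (a (2 - e))"
  have sub: "dif_class k \<subseteq> C" "tot_class k \<subseteq> C" for k
    by (auto simp: dif_class_def tot_class_def)
  have sums: "\<bar>(\<Sum>c\<in>dif_class e. g (D c)) - real n * H A / 80\<bar> \<le> 750000"
      "\<bar>(\<Sum>c\<in>tot_class e. g (T c)) - real n * H A / 80\<bar> \<le> 750000"
      "\<bar>(\<Sum>c\<in>dif_class (2 - e). g (D c)) - real n * H B / 80\<bar> \<le> 750000"
      "\<bar>(\<Sum>c\<in>tot_class (2 - e). g (T c)) - real n * H B / 80\<bar> \<le> 750000"
    if g: "profile g H" "g 50 \<le> 2500" for g H
  proof -
    show "\<bar>(\<Sum>c\<in>dif_class e. g (D c)) - real n * H A / 80\<bar> \<le> 750000"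
      using diagonal_sum[OF g a(3)[OF e(1)] sub(1) coordinate_bounds(3), of "a e"] a(1)[OF e(1)]
      by (simp add: D_def A_def)
    show "\<bar>(\<Sum>c\<in>dif_class (2 - e). g (D c)) - real n * H B / 80\<bar> \<le> 750000"
      using diagonal_sum[OF g a(3)[OF e(2)] sub(1) coordinate_bounds(3), of "a (2 - e)"] a(1)[OF e(2)]
      by (simp add: D_def B_def)
    show "\<bar>(\<Sum>c\<in>tot_class e. g (T c)) - real n * H A / 80\<bar> \<le> 750000"
      using diagonal_sum[OF g a(4)[OF e(1)] sub(2) coordinate_bounds(4), of "a e"]
        a(1)[OF e(1)] a(1)[OF e(2)] e(4)
      by (simp add: T_def A_def abs_le_iff)
    show "\<bar>(\<Sum>c\<in>tot_class (2 - e). g (T c)) - real n * H B / 80\<bar> \<le> 750000"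
      using diagonal_sum[OF g a(4)[OF e(2)] sub(2) coordinate_bounds(4), of "a (2 - e)"]
        a(1)[OF e(1)] a(1)[OF e(2)] e(4)
      by (simp add: T_def B_def abs_le_iff)
  qed
  have lw: "line_weight 50 \<le> 2500" and dw: "diagonal_weight 50 \<le> 2500" and sq: "(50::real)\<^sup>2 \<le> 2500"
    by (simp_all add: line_weight_simps diagonal_weight_simps)
  have cubes: "A ^ 3 + B ^ 3 \<le> 32000 + 1 / 100"
  proof -
    have "(\<Sum>c\<in>C. (D c)\<^sup>2) + (\<Sum>c\<in>C. (T c)\<^sup>2) = 2 * (\<Sum>c\<in>C. (X c)\<^sup>2) + 2 * (\<Sum>c\<in>C. (Y c)\<^sup>2)"
      unfolding sum_distrib_left sum.distrib[symmetric]
      by (rule sum.cong) (auto simp: D_T_eq power2_eq_square algebra_simps)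
    then have "2 * (real n * (A ^ 3 / 3) / 80) + 2 * (real n * (B ^ 3 / 3) / 80) - 4 * 750000
        \<le> 4 * (real n * (20 ^ 3 / 3) / 40 + 750000)"
      using sum_classes_le[OF e(1), of "\<lambda>c. (D c)\<^sup>2"] sum_classes_le[OF e(1), of "\<lambda>c. (T c)\<^sup>2"]
        sums[OF profile_square sq] line_sums[OF profile_square sq]
      unfolding abs_le_iff by (simp add: algebra_simps)
    then have "real n * (A ^ 3 + B ^ 3 - 32000) \<le> 720000000" by (simp add: algebra_simps)
    also have "\<dots> \<le> real n * (1 / 100)" using real_n by simp
    finally show ?thesis using real_n by (simp add: mult_le_cancel_left)
  qed
  have cert: "4 * line_integral 20 \<le> 2 * diagonal_integral A + 2 / 3 * B ^ 3 + 195 * A + 1 / 100"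
  proof -
    have "195 * real (card (dif_class e)) \<le> 195 * (real n * A / 80 + 30)"
    proof -
      have "real n * A = 2 * (scale * real n) * of_int (a e)" by (simp add: A_def)
      then show ?thesis using a(5)[OF e(1)] unfolding scale(2) by simp
    qed
    then have "2 * (real n * line_integral 20 / 40) - 2 * 750000
        \<le> 2 * (real n * diagonal_integral A / 80) + 195 * (real n * A / 80 + 30)
          + 2 * (real n * (B ^ 3 / 3) / 80) + 4 * 750000 + 40000"
      using certificate_sum[OF e(1)] line_sums[OF profile_line_weight lw]
        sums(1,2)[OF profile_diagonal_weight dw] sums(3,4)[OF profile_square sq]
      unfolding abs_le_iff by linarith
    then have "real n * (4 * line_integral 20 - (2 * diagonal_integral A + 2 / 3 * B ^ 3 + 195 * A)) \<le> 10 ^ 9"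
      by (simp add: algebra_simps)
    also have "\<dots> \<le> real n * (1 / 100)" using real_n by simp
    finally show ?thesis using real_n by (simp add: mult_le_cancel_left)
  qed
  show False
  proof (rule certificate_contradiction[OF _ _ _ cubes cert])
    show "0 \<le> B" using scale a(1)[OF e(2)] by (simp add: B_def)
    show "B \<le> A" using scale e(3) by (simp add: A_def B_def)
    have "A + B - 40 = 2 * scale * (of_int (a e + a (2 - e)) - real n)"
      using scale(2) by (simp add: A_def B_def algebra_simps)
    moreover have "\<bar>of_int (a e + a (2 - e)) - real n\<bar> \<le> 81" using e(4) by linarith
    ultimately have "\<bar>A + B - 40\<bar> \<le> 2 * scale * 81" using scale by (simp add: abs_mult)
    also have "\<dots> \<le> 1 / 10 ^ 6" using real_n by (simp add: scale_def field_simps)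
    finally show "\<bar>A + B - 40\<bar> \<le> 1 / 10 ^ 6" .
  qed
qed

end

lemma orthodox_cover_large:
  assumes "10 ^ 11 \<le> n" "orthodox_cover n C"
  shows "n + 3 < 2 * card C"
proof (rule ccontr)
  assume "\<not> n + 3 < 2 * card C"
  obtain p q where pq: "p \<in> {0, 1}" "q \<in> {0, 1}"
      "\<forall>x\<in>{0..<int n}. x mod 2 = p \<longrightarrow> (\<exists>y. (x, y) \<in> C)"
      "\<forall>y\<in>{0..<int n}. y mod 2 = q \<longrightarrow> (\<exists>x. (x, y) \<in> C)"
    using assms(2) unfolding orthodox_cover_def by (elim conjE bexE)
  have pq_mod: "p mod 2 = p" "q mod 2 = q" using pq(1,2) by auto
  have dom: "dominating_set (board n) queen_adj C" using assms(2) by (simp add: orthodox_cover_def)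
  have "small_orthodox_cover n C p q"
  proof
    show "C \<subseteq> board n" using dom by (simp add: dominating_set_def)
    show "v \<in> C \<or> (\<exists>c\<in>C. queen_adj v c)" if "v \<in> board n" for v
      using dom that by (auto simp: dominating_set_def)
    show "\<exists>y. (x, y) \<in> C" if "0 \<le> x" "x < int n" "x mod 2 = p mod 2" for x
      using bspec[OF pq(3), of x] that pq_mod by simp
    show "\<exists>x. (x, y) \<in> C" if "0 \<le> y" "y < int n" "y mod 2 = q mod 2" for y
      using bspec[OF pq(4), of y] that pq_mod by simp
    show "2 * card C \<le> n + 3" using \<open>\<not> n + 3 < 2 * card C\<close> by simp
    show "10 ^ 11 \<le> n" by (rule assms(1))
  qed
  then show False by (rule small_orthodox_cover.impossible)
qed

lemma minimum_dominating_set_exists: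
  "\<exists>C. minimum_dominating_set V adj C"
proof -
  have "\<exists>k C. dominating_set V adj C \<and> card C = k"
    by (intro exI[of _ V] exI) (auto simp: dominating_set_def)
  then show ?thesis
    unfolding minimum_dominating_set_def domination_number_def by (rule LeastI_ex)
qed

theorem corollary11p1:
  shows "\<not> ((\<exists>n0::nat. \<forall>n\<ge>n0. \<forall>C.
              minimum_dominating_set (board n) queen_adj C \<longrightarrow> orthodox_cover n C) \<and>
            (\<forall>n::nat. n \<ge> 1 \<and> n \<notin> {3, 11} \<longrightarrow>
              int (\<gamma>\<^sub>Q n) \<in> {\<lceil>real n / 2\<rceil>, \<lceil>real n / 2\<rceil> + 1}))"
proof
  assume *: "(\<exists>n0::nat. \<forall>n\<ge>n0. \<forall>C.
              minimum_dominating_set (board n) queen_adj C \<longrightarrow> orthodox_cover n C) \<and>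
            (\<forall>n::nat. n \<ge> 1 \<and> n \<notin> {3, 11} \<longrightarrow>
              int (\<gamma>\<^sub>Q n) \<in> {\<lceil>real n / 2\<rceil>, \<lceil>real n / 2\<rceil> + 1})"
  then obtain n0 :: nat where n0: "\<And>n C. n0 \<le> n \<Longrightarrow>
      minimum_dominating_set (board n) queen_adj C \<Longrightarrow> orthodox_cover n C" by blast
  define n where "n = n0 + 10 ^ 11"
  obtain C where C: "minimum_dominating_set (board n) queen_adj C"
    using minimum_dominating_set_exists by blast
  have "orthodox_cover n C" using n0[OF _ C] by (simp add: n_def)
  then have "n + 3 < 2 * card C" by (intro orthodox_cover_large) (simp add: n_def)
  moreover have "card C = \<gamma>\<^sub>Q n"
    using C by (simp add: minimum_dominating_set_def queens_domination_number_def)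
  moreover have "int (\<gamma>\<^sub>Q n) \<in> {\<lceil>real n / 2\<rceil>, \<lceil>real n / 2\<rceil> + 1}"
  proof -
    have "1 \<le> n \<and> n \<notin> {3, 11}" by (simp add: n_def)
    then show ?thesis using * by blast
  qed
  then have "int (\<gamma>\<^sub>Q n) \<le> \<lceil>real n / 2\<rceil> + 1" by auto
  then have "2 * \<gamma>\<^sub>Q n \<le> n + 3" by linarith
  ultimately show False by simp
qed

end
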